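(* Let $R$ be a field, $q\in R$ and $n\ge1$. (a) For each signed composition $\lambda$ of $n$, $\Sigma_q(n)$ has a unique one-dimensional representation $I(\lambda)$ on which $E_\alpha$ acts as multiplication by $d_{\lambda\alpha\lambda}(q)$, for every signed composition $\alpha$ of $n$. (b) Every irreducible representation of $\Sigma_q(n)$ is isomorphic to $I(\lambda)$ for some signed composition $\lambda$ of $n$. (c) If $\lambda\sim\mu$ then $I(\lambda)\cong I(\mu)$.
   Context: A signed composition of $n$ is a sequence $\mu=(\mu_1,\dots,\mu_k)$ of nonzero integers with $\sum|\mu_i|=n$; $\lambda\sim\mu$ means $\mu$ is obtained from $\lambda$ by permuting its parts. For signed compositions $\mu$ (length $k$) and $\nu$ (length $l$) let $\mathcal N_{\mu\nu}$ be the set of $k\times l$ integer matrices $M=(m_{ij})$ with $\sum_j|m_{ij}|=|\mu_i|$, $\sum_i|m_{ij}|=|\nu_j|$, $m_{ij}\le0$ whenever $\mu_i<0$ or $\nu_j<0$, and $m_{ij}\ge0$ whenever $\mu_i>0$ and $\nu_j>0$. Put $\operatorname{wt}(M)=-\sum_{i:\mu_i<0,\ j:\nu_j<0}m_{ij}$ and let $\operatorname{comp}(M)$ be the signed composition listing the nonzero entries of $M$ row by row, left to right. $d_{\mu\nu\sigma}(x)=\sum_{M\in\mathcal N_{\mu\nu},\ \operatorname{comp}(M)=\sigma}x^{\operatorname{wt}(M)}$. $\Sigma_q(n)$ is the $R$-algebra with generators $\{E_\mu\}$ ($\mu$ signed compositions of $n$) and relations $E_\mu E_\nu=\sum_\sigma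 d_{\mu\nu\sigma}(q)E_\sigma$; it is free with basis $\{E_\mu\}$ and has identity $E_{(n)}$. *)

theory Defs
  imports
    "HOL-Combinatorics.List_Permutation"
    "Jordan_Normal_Form.Matrix"
begin

definition signed_compositions :: "nat \<Rightarrow> int list set" where
  "signed_compositions n = {\<mu>. 0 \<notin> set \<mu> \<and> (\<Sum>a\<leftarrow>\<mu>. \<bar>a\<bar>) = int n}"

definition NN :: "int list \<Rightarrow> int list \<Rightarrow> int mat set" where
  "NN \<mu> \<nu> = {M \<in> carrier_mat (length \<mu>) (length \<nu>).
     (\<forall>i<length \<mu>. (\<Sum>j<length \<nu>. \<bar>M $$ (i, j)\<bar>) = \<bar>\<mu> ! i\<bar>) \<and>
     (\<forall>j<length \<nu>. (\<Sum>i<length \<mu>. \<bar>M $$ (i, j)\<bar>) = \<bar>\<nu> ! j\<bar>) \<and>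
     (\<forall>i<length \<mu>. \<forall>j<length \<nu>.
        (\<mu> ! i < 0 \<or> \<nu> ! j < 0 \<longrightarrow> M $$ (i, j) \<le> 0) \<and>
        (\<mu> ! i > 0 \<and> \<nu> ! j > 0 \<longrightarrow> M $$ (i, j) \<ge> 0))}"

text \<open>For a matrix in \<open>NN \<mu> \<nu>\<close> the entries summed below are all nonpositive, so the
  conversion to \<^typ>\<open>nat\<close> is lossless.\<close>

definition wt :: "int list \<Rightarrow> int list \<Rightarrow> int mat \<Rightarrow> nat" where
  "wt \<mu> \<nu> M = nat (- (\<Sum>i | i < length \<mu> \<and> \<mu> ! i < 0.
                       \<Sum>j | j < length \<nu> \<and> \<nu> ! j < 0. M $$ (i, j)))"

definition comp_mat :: "int mat \<Rightarrow> int list" where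
  "comp_mat M = filter (\<lambda>a. a \<noteq> 0) (concat (mat_to_list M))"

definition dcoeff :: "int list \<Rightarrow> int list \<Rightarrow> int list \<Rightarrow> 'a::comm_semiring_1 \<Rightarrow> 'a" where
  "dcoeff \<mu> \<nu> \<sigma> x = (\<Sum>M | M \<in> NN \<mu> \<nu> \<and> comp_mat M = \<sigma>. x ^ wt \<mu> \<nu> M)"

text \<open>
  The algebra $\Sigma_q(n)$ is realised on the free module with basis the signed compositions
  of $n$: an element is its coefficient function, which vanishes off
  \<open>signed_compositions n\<close>. Addition and scalar multiplication are pointwise;
  multiplication is the bilinear extension of the defining relations (see \<open>sq_mult_basis\<close>).
\<close>

definition sq_carrier :: "nat \<Rightarrow> (int list \<Rightarrow> 'r::field) set" where
  "sq_carrier n = {f. \<forall>\<mu>. \<mu> \<notin> signed_compositions n \<longrightarrow> f \<mu> = 0}"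

definition sq_basis :: "int list \<Rightarrow> int list \<Rightarrow> 'r::field" where
  "sq_basis \<mu> = (\<lambda>\<sigma>. if \<sigma> = \<mu> then 1 else 0)"

definition sq_mult :: "nat \<Rightarrow> 'r::field \<Rightarrow> (int list \<Rightarrow> 'r) \<Rightarrow> (int list \<Rightarrow> 'r) \<Rightarrow> int list \<Rightarrow> 'r" where
  "sq_mult n q f g = (\<lambda>\<sigma>. \<Sum>\<mu>\<in>signed_compositions n. \<Sum>\<nu>\<in>signed_compositions n.
     f \<mu> * g \<nu> * dcoeff \<mu> \<nu> \<sigma> q)"

definition sq_one :: "nat \<Rightarrow> int list \<Rightarrow> 'r::field" where
  "sq_one n = sq_basis [int n]"

text \<open>
  A representation is a unital algebra homomorphism \<open>\<rho>\<close> into the linear endomorphisms of a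
  vector space, which is the whole type \<open>'v\<close> with scalar multiplication \<open>scale\<close>. The values
  of \<open>\<rho>\<close> outside \<open>sq_carrier n\<close> are irrelevant.
\<close>

locale sq_representation = vector_space scale
  for scale :: "'r::field \<Rightarrow> 'v::ab_group_add \<Rightarrow> 'v" +
  fixes n :: nat and q :: 'r and \<rho> :: "(int list \<Rightarrow> 'r) \<Rightarrow> 'v \<Rightarrow> 'v"
  assumes linear_rep: "f \<in> sq_carrier n \<Longrightarrow> Vector_Spaces.linear scale scale (\<rho> f)"
    and rep_add: "\<lbrakk>f \<in> sq_carrier n; g \<in> sq_carrier n\<rbrakk> \<Longrightarrow> \<rho> (\<lambda>\<mu>. f \<mu> + g \<mu>) v = \<rho> f v + \<rho> g v"
    and rep_scale: "f \<in> sq_carrier n \<Longrightarrow> \<rho> (\<lambda>\<mu>. c * f \<mu>) v = scale c (\<rho> f v)"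
    and rep_mult: "\<lbrakk>f \<in> sq_carrier n; g \<in> sq_carrier n\<rbrakk> \<Longrightarrow> \<rho> (sq_mult n q f g) v = \<rho> f (\<rho> g v)"
    and rep_one: "\<rho> (sq_one n) v = v"

definition one_dim_representation ::
  "('r::field \<Rightarrow> 'v::ab_group_add \<Rightarrow> 'v) \<Rightarrow> nat \<Rightarrow> 'r \<Rightarrow> ((int list \<Rightarrow> 'r) \<Rightarrow> 'v \<Rightarrow> 'v) \<Rightarrow> bool" where
  "one_dim_representation scale n q \<rho> \<longleftrightarrow>
     sq_representation scale n q \<rho> \<and> vector_space.dim scale UNIV = 1"

definition irreducible_representation ::
  "('r::field \<Rightarrow> 'v::ab_group_add \<Rightarrow> 'v) \<Rightarrow> nat \<Rightarrow> 'r \<Rightarrow> ((int list \<Rightarrow> 'r) \<Rightarrow> 'v \<Rightarrow> 'v) \<Rightarrow> bool" where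
  "irreducible_representation scale n q \<rho> \<longleftrightarrow>
     sq_representation scale n q \<rho> \<and> (\<exists>v::'v. v \<noteq> 0) \<and>
     (\<forall>W. module.subspace scale W \<and> (\<forall>f\<in>sq_carrier n. \<forall>w\<in>W. \<rho> f w \<in> W)
          \<longrightarrow> W = {0} \<or> W = UNIV)"

definition isomorphic_representations ::
  "nat \<Rightarrow> ('r::field \<Rightarrow> 'v::ab_group_add \<Rightarrow> 'v) \<Rightarrow> ((int list \<Rightarrow> 'r) \<Rightarrow> 'v \<Rightarrow> 'v) \<Rightarrow>
   ('r \<Rightarrow> 'w::ab_group_add \<Rightarrow> 'w) \<Rightarrow> ((int list \<Rightarrow> 'r) \<Rightarrow> 'w \<Rightarrow> 'w) \<Rightarrow> bool" where
  "isomorphic_representations n scale1 \<rho>1 scale2 \<rho>2 \<longleftrightarrow>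
     (\<exists>\<phi>. Vector_Spaces.linear scale1 scale2 \<phi> \<and> bij \<phi> \<and>
          (\<forall>f\<in>sq_carrier n. \<forall>v. \<phi> (\<rho>1 f v) = \<rho>2 f (\<phi> v)))"

text \<open>
  \<open>I(\<lambda>)\<close> lives on the field itself, regarded as a vector space with scalar multiplication
  \<open>(*)\<close>; it is the linear extension of \<open>E\<^sub>\<alpha> \<mapsto> d\<^sub>\<lambda>\<^sub>\<alpha>\<^sub>\<lambda>(q)\<close>. That this is multiplicative and
  unital, i.e. a representation, is not part of the definition.
\<close>

definition I_rep :: "nat \<Rightarrow> 'r::field \<Rightarrow> int list \<Rightarrow> (int list \<Rightarrow> 'r) \<Rightarrow> 'r \<Rightarrow> 'r" where
  "I_rep n q lam f x = (\<Sum>\<alpha>\<in>signed_compositions n. f \<alpha> * dcoeff lam \<alpha> lam q) * x"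

text \<open>The index sets are finite, so the sums above are genuine.\<close>

lemma finite_signed_compositions: "finite (signed_compositions n)"
proof -
  have len: "int (length \<mu>) \<le> (\<Sum>a\<leftarrow>\<mu>. \<bar>a\<bar>)" if "0 \<notin> set \<mu>" for \<mu> :: "int list"
    using that by (induction \<mu>) auto
  have mem: "\<bar>b\<bar> \<le> (\<Sum>a\<leftarrow>\<mu>. \<bar>a\<bar>)" if "b \<in> set \<mu>" for b and \<mu> :: "int list"
    using that by (intro member_le_sum_list) auto
  have "signed_compositions n \<subseteq> {\<mu>. set \<mu> \<subseteq> {- int n..int n} \<and> length \<mu> \<le> n}"
  proof (intro subsetI CollectI conjI)
    fix \<mu> b assume m: "\<mu> \<in> signed_compositions n" and b: "b \<in> set \<mu>"
    show "b \<in> {- int n..int n}"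
      using mem[OF b] m by (auto simp: signed_compositions_def)
  next
    fix \<mu> assume "\<mu> \<in> signed_compositions n"
    then show "length \<mu> \<le> n" using len[of \<mu>] by (auto simp: signed_compositions_def)
  qed
  then show ?thesis
    by (rule finite_subset) (rule finite_lists_length_le, simp)
qed

lemma finite_NN: "finite (NN \<mu> \<nu>)"
proof -
  let ?I = "{..<length \<mu>} \<times> {..<length \<nu>}"
  let ?B = "\<Sum>a\<leftarrow>\<mu>. \<bar>a\<bar>"
  have bound: "M $$ (i, j) \<in> {- ?B..?B}"
    if M: "M \<in> NN \<mu> \<nu>" and i: "i < length \<mu>" and j: "j < length \<nu>" for M i j
  proof -
    have "\<bar>M $$ (i, j)\<bar> \<le> (\<Sum>j<length \<nu>. \<bar>M $$ (i, j)\<bar>)"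
      using j by (intro member_le_sum) auto
    also have "\<dots> = \<bar>\<mu> ! i\<bar>" using M i by (auto simp: NN_def)
    also have "\<dots> \<le> ?B"
      using i by (intro member_le_sum_list) auto
    finally show ?thesis by auto
  qed
  have "NN \<mu> \<nu> \<subseteq> mat (length \<mu>) (length \<nu>) ` (?I \<rightarrow>\<^sub>E {- ?B..?B})"
  proof
    fix M assume M: "M \<in> NN \<mu> \<nu>"
    then have c: "M \<in> carrier_mat (length \<mu>) (length \<nu>)" by (auto simp: NN_def)
    have "M = mat (length \<mu>) (length \<nu>) (restrict (\<lambda>p. M $$ p) ?I)"
      using c by (intro eq_matI) auto
    moreover have "restrict (\<lambda>p. M $$ p) ?I \<in> ?I \<rightarrow>\<^sub>E {- ?B..?B}"
      using bound[OF M] by auto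
    ultimately show "M \<in> mat (length \<mu>) (length \<nu>) ` (?I \<rightarrow>\<^sub>E {- ?B..?B})" by blast
  qed
  then show ?thesis
    by (rule finite_subset) (intro finite_imageI finite_PiE; simp)
qed

lemma sum_list_comp_mat:
  "(\<Sum>a\<leftarrow>comp_mat M. \<bar>a\<bar>) = (\<Sum>i<dim_row M. \<Sum>j<dim_col M. \<bar>M $$ (i, j)\<bar>)"
proof -
  have "(\<Sum>a\<leftarrow>filter (\<lambda>a. a \<noteq> 0) xs. \<bar>a\<bar>) = (\<Sum>a\<leftarrow>xs. \<bar>a\<bar>)" for xs :: "int list"
    by (induction xs) auto
  moreover have "(\<Sum>a\<leftarrow>concat xss. \<bar>a\<bar>) = (\<Sum>xs\<leftarrow>xss. \<Sum>a\<leftarrow>xs. \<bar>a\<bar>)" for xss :: "int list list"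
    by (induction xss) auto
  ultimately show ?thesis
    by (simp add: comp_mat_def mat_to_list_def o_def interv_sum_list_conv_sum_set_nat
        atLeast0LessThan)
qed

lemma comp_mat_signed_composition:
  assumes "\<mu> \<in> signed_compositions n" and "M \<in> NN \<mu> \<nu>"
  shows "comp_mat M \<in> signed_compositions n"
proof -
  have "(\<Sum>a\<leftarrow>comp_mat M. \<bar>a\<bar>) = (\<Sum>i<length \<mu>. \<bar>\<mu> ! i\<bar>)"
    using assms(2) unfolding sum_list_comp_mat NN_def by auto
  also have "\<dots> = (\<Sum>a\<leftarrow>\<mu>. \<bar>a\<bar>)"
    by (simp add: sum_list_sum_nth atLeast0LessThan)
  finally show ?thesis
    using assms(1) by (auto simp: signed_compositions_def comp_mat_def)
qed

lemma sq_mult_basis: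
  assumes "\<mu> \<in> signed_compositions n" and "\<nu> \<in> signed_compositions n"
  shows "sq_mult n q (sq_basis \<mu>) (sq_basis \<nu>) =
    (\<lambda>\<tau>. \<Sum>\<sigma>\<in>signed_compositions n. dcoeff \<mu> \<nu> \<sigma> q * sq_basis \<sigma> \<tau>)"
proof
  fix \<tau>
  have out: "dcoeff \<mu> \<nu> \<tau> q = 0" if "\<tau> \<notin> signed_compositions n"
  proof -
    have "{M. M \<in> NN \<mu> \<nu> \<and> comp_mat M = \<tau>} = {}"
      using comp_mat_signed_composition[OF assms(1)] that by blast
    then show ?thesis unfolding dcoeff_def by (simp only: sum.empty)
  qed
  have "sq_mult n q (sq_basis \<mu>) (sq_basis \<nu>) \<tau> =
      (\<Sum>\<mu>'\<in>signed_compositions n. \<Sum>\<nu>'\<in>signed_compositions n.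
         if \<nu>' = \<nu> then (if \<mu>' = \<mu> then dcoeff \<mu>' \<nu>' \<tau> q else 0) else 0)"
    unfolding sq_mult_def sq_basis_def by (intro sum.cong) auto
  also have "\<dots> = dcoeff \<mu> \<nu> \<tau> q"
    using assms by (simp add: sum.delta finite_signed_compositions)
  also have "\<dots> = (\<Sum>\<sigma>\<in>signed_compositions n. if \<sigma> = \<tau> then dcoeff \<mu> \<nu> \<sigma> q else 0)"
    using out by (simp add: sum.delta finite_signed_compositions)
  also have "\<dots> = (\<Sum>\<sigma>\<in>signed_compositions n. dcoeff \<mu> \<nu> \<sigma> q * sq_basis \<sigma> \<tau>)"
    unfolding sq_basis_def by (intro sum.cong) auto
  finally show "sq_mult n q (sq_basis \<mu>) (sq_basis \<nu>) \<tau> =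
      (\<Sum>\<sigma>\<in>signed_compositions n. dcoeff \<mu> \<nu> \<sigma> q * sq_basis \<sigma> \<tau>)" .
qed

end

theory Submission
  imports Defs
begin

text \<open>
  A matrix in \<open>NN \<lambda> \<alpha>\<close> with composition \<open>\<lambda>\<close> has exactly one nonzero entry \<open>\<lambda>\<^sub>i\<close> in row \<open>i\<close>. It
  is a map \<open>f\<close> from the parts of \<open>\<lambda>\<close> to those of \<open>\<alpha>\<close> whose fibres have absolute sums
  \<open>\<bar>\<alpha>\<^sub>j\<bar>\<close> and which sends only negative parts to negative parts, and its weight is the
  absolute sum of the negative parts of \<open>\<alpha>\<close>. Hence \<open>d\<^sub>\<lambda>\<^sub>\<alpha>\<^sub>\<lambda>(q)\<close> is a power of \<open>q\<close> depending
  only on \<open>\<alpha>\<close> times the number of such maps, which is invariant under permutations of \<open>\<lambda>\<close>. It is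
  multiplicative in \<open>\<alpha>\<close> because a pair of maps to \<open>\<alpha>\<close> and \<open>\<beta>\<close> is the same as a matrix
  in \<open>NN \<alpha> \<beta>\<close> with a map to its nonzero entries.

  For irreducible representations, right multiplication by \<open>E\<^sub>\<alpha>\<close> is triangular on the basis, with
  diagonal entries \<open>d\<^sub>\<lambda>\<^sub>\<alpha>\<^sub>\<lambda>(q)\<close>. So every nonzero representation contains a common eigenvector
  belonging to one of these characters, and it spans an irreducible representation.
\<close>

section \<open>Fibre maps between weighted index sets\<close>

text \<open>The index sets are arbitrary because targets occur both as positions of a list and as
  cells of a matrix. Extensional functions are used so that counting them makes sense.\<close>

definition fibre_maps :: "'i set \<Rightarrow> ('i \<Rightarrow> int) \<Rightarrow> 'j set \<Rightarrow> ('j \<Rightarrow> int) \<Rightarrow> ('i \<Rightarrow> 'j) set" where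
  "fibre_maps I w J a = {f \<in> I \<rightarrow>\<^sub>E J.
     (\<forall>j\<in>J. (\<Sum>i | i \<in> I \<and> f i = j. \<bar>w i\<bar>) = \<bar>a j\<bar>) \<and> (\<forall>i\<in>I. a (f i) < 0 \<longrightarrow> w i < 0)}"

text \<open>Since \<open>nat\<close> truncates, positive values contribute 0, and the result is the
  absolute sum of the negative values.\<close>

definition negpart :: "'j set \<Rightarrow> ('j \<Rightarrow> int) \<Rightarrow> nat" where
  "negpart J a = (\<Sum>j\<in>J. nat (- a j))"

lemma finite_fibre_maps:
  assumes "finite I" "finite J"
  shows "finite (fibre_maps I w J a)"
  by (rule finite_subset[OF _ finite_PiE[of I "\<lambda>_. J"]]) (use assms in \<open>auto simp: fibre_maps_def\<close>)

text \<open>Conjugation \<open>f\<close> to \<open>t o f o s'\<close> is injective and preserves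
  fibre sums and signs. Both inverses are explicit arguments, so that exchanging the roles of the
  two sides yields the reverse inequality.\<close>

lemma card_fibre_maps_le:
  assumes "finite I'" "finite J'"
    and s: "\<And>i. i \<in> I \<Longrightarrow> s i \<in> I'" "\<And>i. i \<in> I' \<Longrightarrow> s' i \<in> I"
      "\<And>i. i \<in> I \<Longrightarrow> s' (s i) = i" "\<And>i. i \<in> I' \<Longrightarrow> s (s' i) = i"
    and t: "\<And>j. j \<in> J \<Longrightarrow> t j \<in> J'" "\<And>j. j \<in> J' \<Longrightarrow> t' j \<in> J"
      "\<And>j. j \<in> J \<Longrightarrow> t' (t j) = j" "\<And>j. j \<in> J' \<Longrightarrow> t (t' j) = j"
    and w: "\<And>i. i \<in> I \<Longrightarrow> w' (s i) = w i"
    and a: "\<And>j. j \<in> J \<Longrightarrow> a' (t j) = a j"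
  shows "card (fibre_maps I w J a) \<le> card (fibre_maps I' w' J' a')"
proof (rule card_inj_on_le)
  let ?F = "\<lambda>f. \<lambda>i\<in>I'. t (f (s' i))"
  show "inj_on ?F (fibre_maps I w J a)"
  proof (rule inj_onI)
    fix f g assume fg: "f \<in> fibre_maps I w J a" "g \<in> fibre_maps I w J a" and eq: "?F f = ?F g"
    have ext: "f \<in> I \<rightarrow>\<^sub>E J" "g \<in> I \<rightarrow>\<^sub>E J" using fg by (auto simp: fibre_maps_def)
    show "f = g"
    proof (rule PiE_ext[OF ext])
      fix i assume i: "i \<in> I"
      have "t (f i) = t (g i)" using fun_cong[OF eq, of "s i"] s i by simp
      then have "t' (t (f i)) = t' (t (g i))" by simp
      then show "f i = g i" using t(3) ext i by (metis PiE_mem)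
    qed
  qed
  show "?F ` fibre_maps I w J a \<subseteq> fibre_maps I' w' J' a'"
  proof
    fix h assume "h \<in> ?F ` fibre_maps I w J a"
    then obtain f where f: "f \<in> fibre_maps I w J a" and h: "h = ?F f" by blast
    have fJ: "f i \<in> J" if "i \<in> I" for i using f that by (auto simp: fibre_maps_def)
    have "(\<Sum>i | i \<in> I' \<and> h i = j. \<bar>w' i\<bar>) = \<bar>a' j\<bar>" if j: "j \<in> J'" for j
    proof -
      have "(\<Sum>i | i \<in> I' \<and> h i = j. \<bar>w' i\<bar>) = (\<Sum>i | i \<in> I \<and> f i = t' j. \<bar>w i\<bar>)"
        by (rule sum.reindex_bij_witness[of _ s s']) (use j s t w fJ h in \<open>auto, metis\<close>)
      also have "\<dots> = \<bar>a (t' j)\<bar>" using f t(2)[OF j] by (auto simp: fibre_maps_def)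
      also have "\<dots> = \<bar>a' j\<bar>" using a[OF t(2)[OF j]] t(4)[OF j] by simp
      finally show ?thesis .
    qed
    moreover have "w' i < 0" if i: "i \<in> I'" and "a' (h i) < 0" for i
    proof -
      have "a (f (s' i)) < 0" using that h a fJ s by auto
      then have "w (s' i) < 0" using f s(2)[OF i] by (auto simp: fibre_maps_def)
      then show ?thesis using w[OF s(2)[OF i]] s(4)[OF i] by simp
    qed
    moreover have "h \<in> I' \<rightarrow>\<^sub>E J'" using h fJ s t by auto
    ultimately show "h \<in> fibre_maps I' w' J' a'" by (auto simp: fibre_maps_def)
  qed
  show "finite (fibre_maps I' w' J' a')" using assms(1,2) by (rule finite_fibre_maps)
qed

lemma card_fibre_maps_reindex:
  assumes "finite I" "finite J" and s: "bij_betw s I I'" and t: "bij_betw t J J'"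
    and w: "\<And>i. i \<in> I \<Longrightarrow> w' (s i) = w i" and a: "\<And>j. j \<in> J \<Longrightarrow> a' (t j) = a j"
  shows "card (fibre_maps I w J a) = card (fibre_maps I' w' J' a')"
proof -
  let ?s = "inv_into I s" and ?t = "inv_into J t"
  have fin: "finite I'" "finite J'" using assms(1,2) s t bij_betw_finite by blast+
  have S: "\<And>i. i \<in> I \<Longrightarrow> s i \<in> I'" "\<And>i. i \<in> I' \<Longrightarrow> ?s i \<in> I"
      "\<And>i. i \<in> I \<Longrightarrow> ?s (s i) = i" "\<And>i. i \<in> I' \<Longrightarrow> s (?s i) = i"
    using s by (auto simp: bij_betw_def inv_into_into f_inv_into_f)
  have T: "\<And>j. j \<in> J \<Longrightarrow> t j \<in> J'" "\<And>j. j \<in> J' \<Longrightarrow> ?t j \<in> J"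
      "\<And>j. j \<in> J \<Longrightarrow> ?t (t j) = j" "\<And>j. j \<in> J' \<Longrightarrow> t (?t j) = j"
    using t by (auto simp: bij_betw_def inv_into_into f_inv_into_f)
  have "w (?s i) = w' i" if "i \<in> I'" for i using w[OF S(2)[OF that]] S(4)[OF that] by simp
  moreover have "a (?t j) = a' j" if "j \<in> J'" for j using a[OF T(2)[OF that]] T(4)[OF that] by simp
  ultimately show ?thesis
    using assms(1,2) fin S T w a
    by (intro antisym card_fibre_maps_le[where s = s and s' = ?s and t = t and t' = ?t]
        card_fibre_maps_le[where s = ?s and s' = s and t = ?t and t' = t]) auto
qed

text \<open>The fibre over \<open>f i\<close> contains \<open>i\<close> itself, so its absolute sum
  is positive.\<close>

lemma fibre_maps_target_nonzero:
  assumes "finite I" and f: "f \<in> fibre_maps I w J a" and i: "i \<in> I" and w: "w i \<noteq> 0"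
  shows "a (f i) \<noteq> 0"
proof -
  have "0 < \<bar>w i\<bar>" using w by simp
  also have "\<bar>w i\<bar> \<le> (\<Sum>i' | i' \<in> I \<and> f i' = f i. \<bar>w i'\<bar>)"
    using i assms(1) by (intro member_le_sum) auto
  also have "\<dots> = \<bar>a (f i)\<bar>" using f i by (auto simp: fibre_maps_def)
  finally show ?thesis by simp
qed

text \<open>A target of value 0 has an empty fibre, so its fibre condition is vacuous. This allows
  the zero cells of a matrix to be dropped or restored.\<close>

lemma fibre_maps_nonzero_targets:
  assumes "finite I" and w: "\<And>i. i \<in> I \<Longrightarrow> w i \<noteq> 0"
  shows "fibre_maps I w {j \<in> J. a j \<noteq> 0} a = fibre_maps I w J a"
proof (rule equalityI; rule subsetI)
  fix f assume f: "f \<in> fibre_maps I w {j \<in> J. a j \<noteq> 0} a"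
  have "(\<Sum>i | i \<in> I \<and> f i = j. \<bar>w i\<bar>) = \<bar>a j\<bar>" if j: "j \<in> J" for j
  proof (cases "a j = 0")
    case True
    then have "{i. i \<in> I \<and> f i = j} = {}" using f by (auto simp: fibre_maps_def)
    then show ?thesis using True by (simp only: sum.empty)
  qed (use f j in \<open>auto simp: fibre_maps_def\<close>)
  then show "f \<in> fibre_maps I w J a" using f by (auto simp: fibre_maps_def)
next
  fix f assume f: "f \<in> fibre_maps I w J a"
  then show "f \<in> fibre_maps I w {j \<in> J. a j \<noteq> 0} a"
    using fibre_maps_target_nonzero[OF assms(1) f _ w] by (auto simp: fibre_maps_def)
qed

section \<open>Parts of \<open>comp_mat M\<close> and nonzero cells of \<open>M\<close>\<close>

text \<open>\<open>List.product\<close> enumerates the cells in the order in which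
  \<open>mat_to_list\<close> reads them, so filtering cells and filtering entries agree. The list
  \<open>ps\<close> is the bijection along which sums and counts are transferred between the parts
  of \<open>comp_mat M\<close> and the cells of \<open>M\<close>.\<close>

lemma comp_mat_positions:
  assumes "M \<in> carrier_mat k l"
  obtains ps where "distinct ps" "set ps = {p \<in> {..<k} \<times> {..<l}. M $$ p \<noteq> 0}"
    "comp_mat M = map (($$) M) ps"
proof
  let ?ps = "filter (\<lambda>p. M $$ p \<noteq> 0) (List.product [0..<k] [0..<l])"
  show "distinct ?ps" by (simp add: distinct_product)
  show "set ?ps = {p \<in> {..<k} \<times> {..<l}. M $$ p \<noteq> 0}" by auto
  have "concat (mat_to_list M) = map (($$) M) (List.product [0..<k] [0..<l])"
    using assms by (auto simp: mat_to_list_def product_concat_map map_concat o_def)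
  then show "comp_mat M = map (($$) M) ?ps"
    by (simp add: comp_mat_def filter_map o_def)
qed

lemma negpart_comp_mat:
  assumes "M \<in> carrier_mat k l"
  shows "negpart {..<length (comp_mat M)} ((!) (comp_mat M)) = negpart ({..<k} \<times> {..<l}) (($$) M)"
proof -
  obtain ps where ps: "distinct ps" "set ps = {p \<in> {..<k} \<times> {..<l}. M $$ p \<noteq> 0}"
    "comp_mat M = map (($$) M) ps" using comp_mat_positions[OF assms] .
  have "negpart {..<length (comp_mat M)} ((!) (comp_mat M)) = (\<Sum>t<length ps. nat (- (M $$ (ps ! t))))"
    unfolding negpart_def ps(3) by (intro sum.cong) auto
  also have "\<dots> = (\<Sum>p\<in>set ps. nat (- (M $$ p)))"
    using sum.reindex_bij_betw[OF bij_betw_nth[OF ps(1) refl refl]] .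
  also have "\<dots> = negpart ({..<k} \<times> {..<l}) (($$) M)"
    unfolding negpart_def ps(2) by (intro sum.mono_neutral_left) auto
  finally show ?thesis .
qed

lemma card_fibre_maps_comp_mat:
  assumes M: "M \<in> carrier_mat k l" and "finite I" and w: "\<And>i. i \<in> I \<Longrightarrow> w i \<noteq> 0"
  shows "card (fibre_maps I w {..<length (comp_mat M)} ((!) (comp_mat M))) =
    card (fibre_maps I w ({..<k} \<times> {..<l}) (($$) M))"
proof -
  obtain ps where ps: "distinct ps" "set ps = {p \<in> {..<k} \<times> {..<l}. M $$ p \<noteq> 0}"
    "comp_mat M = map (($$) M) ps" using comp_mat_positions[OF M] .
  have len: "length (comp_mat M) = length ps" using ps(3) by simp
  have "card (fibre_maps I w {..<length (comp_mat M)} ((!) (comp_mat M))) =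
      card (fibre_maps I w {p \<in> {..<k} \<times> {..<l}. M $$ p \<noteq> 0} (($$) M))"
    by (rule card_fibre_maps_reindex[of I _ id I "(!) ps"])
      (use assms(2) ps bij_betw_nth[OF ps(1) len[THEN arg_cong, of lessThan] refl] in auto)
  then show ?thesis by (simp only: fibre_maps_nonzero_targets[OF assms(2) w])
qed

text \<open>The entries summed are nonpositive, so \<open>nat\<close> commutes with the sums. Full
  index ranges, with the sign conditions moved into the summand, allow the order of summation to be
  exchanged.\<close>

lemma wt_eq:
  assumes "M \<in> NN \<mu> \<nu>"
  shows "wt \<mu> \<nu> M = (\<Sum>i<length \<mu>. \<Sum>j<length \<nu>. if \<mu> ! i < 0 \<and> \<nu> ! j < 0 then nat (- (M $$ (i, j))) else 0)"
    (is "_ = ?R")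
proof -
  have "int ?R = (\<Sum>i<length \<mu>. \<Sum>j<length \<nu>. if \<mu> ! i < 0 \<and> \<nu> ! j < 0 then - (M $$ (i, j)) else 0)"
    unfolding of_nat_sum using assms by (intro sum.cong) (auto simp: NN_def)
  also have "\<dots> = (\<Sum>i<length \<mu>. if \<mu> ! i < 0 then (\<Sum>j<length \<nu>. if \<nu> ! j < 0 then - (M $$ (i, j)) else 0) else 0)"
    by (intro sum.cong) auto
  also have "\<dots> = (\<Sum>i\<in>{i\<in>{..<length \<mu>}. \<mu> ! i < 0}. \<Sum>j\<in>{j\<in>{..<length \<nu>}. \<nu> ! j < 0}. - (M $$ (i, j)))"
    by (simp only: sum.inter_filter[symmetric] finite_lessThan)
  also have "\<dots> = - (\<Sum>i | i < length \<mu> \<and> \<mu> ! i < 0. \<Sum>j | j < length \<nu> \<and> \<nu> ! j < 0. M $$ (i, j))"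
    by (simp add: sum_negf)
  finally have eq: "int ?R = \<dots>" .
  show ?thesis unfolding wt_def eq[symmetric] by (rule nat_int)
qed

section \<open>Triangularity of the structure constants with respect to rank\<close>

text \<open>
  Passing from a part to the nonzero entries of the corresponding row of a matrix in
  \<open>NN \<mu> \<nu>\<close> splits it or makes it negative; negative parts only split into negative ones. Counting
  negative parts twice makes each such change increase the rank.
\<close>

definition sc_rank :: "int list \<Rightarrow> nat" where
  "sc_rank \<mu> = (\<Sum>a\<leftarrow>\<mu>. if a < 0 then 2 else 1)"

lemma sc_rank_row:
  assumes "a \<noteq> 0" "(\<Sum>x\<leftarrow>xs. \<bar>x\<bar>) = \<bar>a\<bar>" "a < 0 \<Longrightarrow> \<forall>x\<in>set xs. x \<le> 0" "0 \<notin> set xs"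
  shows "xs = [a] \<or> sc_rank [a] < sc_rank xs"
proof (cases xs)
  case (Cons y ys)
  then show ?thesis
  proof (cases ys)
    case Nil
    \<comment> \<open>A single entry is \<open>a\<close> or \<open>- a\<close>, and the latter only
      for positive \<open>a\<close>, where the rank rises from 1 to 2.\<close>
    then show ?thesis using assms Cons by (auto simp: sc_rank_def)
  next
    case ys: (Cons z zs)
    \<comment> \<open>With two or more entries the rank of \<open>xs\<close> is at least 2, and at
      least 4 if \<open>a\<close> is negative, since then every entry is negative.\<close>
    have "sc_rank [a] < sc_rank xs"
      using assms(3,4) unfolding Cons ys sc_rank_def by (cases "a < 0") force+
    then show ?thesis ..
  qed
qed (use assms in simp)

lemma sc_rank_rows:
  assumes "list_all2 (\<lambda>a xs. xs = [a] \<or> sc_rank [a] < sc_rank xs) \<mu> xss"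
  shows "xss = map (\<lambda>a. [a]) \<mu> \<or> sc_rank \<mu> < sc_rank (concat xss)"
  using assms
proof (induction rule: list_all2_induct)
  case (Cons a \<mu> xs xss)
  have "sc_rank (a # \<mu>) = sc_rank [a] + sc_rank \<mu>"
    "sc_rank (concat (xs # xss)) = sc_rank xs + sc_rank (concat xss)"
    by (auto simp: sc_rank_def)
  then show ?case using Cons by auto
qed simp

text \<open>The flat list \<open>comp_mat M\<close> forgets the row boundaries, and the rank
  recovers them: if \<open>comp_mat M\<close> equals \<mu>, the ranks coincide, the strict
  alternative is excluded, and every row contains exactly its own part.\<close>

lemma NN_rows:
  assumes M: "M \<in> NN \<mu> \<nu>" and \<mu>: "0 \<notin> set \<mu>"
  shows "map (filter (\<lambda>a. a \<noteq> 0)) (mat_to_list M) = map (\<lambda>a. [a]) \<mu> \<or> sc_rank \<mu> < sc_rank (comp_mat M)"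
proof -
  have "list_all2 (\<lambda>a xs. xs = [a] \<or> sc_rank [a] < sc_rank xs) \<mu>
      (map (filter (\<lambda>a. a \<noteq> 0)) (mat_to_list M))"
  proof (rule list_all2_all_nthI)
    show "length \<mu> = length (map (filter (\<lambda>a. a \<noteq> 0)) (mat_to_list M))"
      using M by (auto simp: NN_def mat_to_list_def)
  next
    fix i assume i: "i < length \<mu>"
    let ?xs = "map (\<lambda>j. M $$ (i, j)) [0..<length \<nu>]"
    have xs: "map (filter (\<lambda>a. a \<noteq> 0)) (mat_to_list M) ! i = filter (\<lambda>a. a \<noteq> 0) ?xs"
      using M i by (auto simp: NN_def mat_to_list_def)
    have "(\<Sum>x\<leftarrow>filter (\<lambda>a. a \<noteq> 0) xs. \<bar>x\<bar>) = (\<Sum>x\<leftarrow>xs. \<bar>x\<bar>)" for xs :: "int list"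
      by (induction xs) auto
    then have "(\<Sum>x\<leftarrow>filter (\<lambda>a. a \<noteq> 0) ?xs. \<bar>x\<bar>) = (\<Sum>j<length \<nu>. \<bar>M $$ (i, j)\<bar>)"
      by (simp add: o_def interv_sum_list_conv_sum_set_nat atLeast0LessThan)
    also have "\<dots> = \<bar>\<mu> ! i\<bar>" using M i by (auto simp: NN_def)
    finally show "map (filter (\<lambda>a. a \<noteq> 0)) (mat_to_list M) ! i = [\<mu> ! i] \<or>
        sc_rank [\<mu> ! i] < sc_rank (map (filter (\<lambda>a. a \<noteq> 0)) (mat_to_list M) ! i)"
      unfolding xs using M i \<mu> by (intro sc_rank_row) (auto simp: NN_def in_set_conv_nth)
  qed
  from sc_rank_rows[OF this] show ?thesis
    by (simp add: comp_mat_def filter_concat)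
qed

lemma dcoeff_eq_0:
  assumes "\<And>M. M \<in> NN \<mu> \<nu> \<Longrightarrow> comp_mat M \<noteq> \<sigma>"
  shows "dcoeff \<mu> \<nu> \<sigma> q = 0"
proof -
  have "{M. M \<in> NN \<mu> \<nu> \<and> comp_mat M = \<sigma>} = {}" using assms by blast
  then show ?thesis unfolding dcoeff_def by (simp only: sum.empty)
qed

lemma dcoeff_triangular:
  assumes "0 \<notin> set \<mu>" and "dcoeff \<mu> \<nu> \<tau> q \<noteq> 0"
  shows "\<tau> = \<mu> \<or> sc_rank \<mu> < sc_rank \<tau>"
proof -
  obtain M where M: "M \<in> NN \<mu> \<nu>" "comp_mat M = \<tau>"
    using assms(2) dcoeff_eq_0 by blast
  then show ?thesis
    using NN_rows[OF M(1) assms(1)] by (auto simp: comp_mat_def filter_concat)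
qed

section \<open>Diagonal coefficients as counts of fibre maps\<close>

lemma filter_nonzero_eq_singleton_iff:
  fixes g :: "nat \<Rightarrow> int"
  shows "filter (\<lambda>a. a \<noteq> 0) (map g [0..<l]) = [a] \<longleftrightarrow>
    a \<noteq> 0 \<and> (\<exists>j<l. g j = a \<and> (\<forall>j'<l. j' \<noteq> j \<longrightarrow> g j' = 0))"
proof
  let ?ys = "filter (\<lambda>j. g j \<noteq> 0) [0..<l]"
  have eq: "filter (\<lambda>a. a \<noteq> 0) (map g [0..<l]) = map g ?ys"
    by (simp add: filter_map o_def)
  {
    assume "filter (\<lambda>a. a \<noteq> 0) (map g [0..<l]) = [a]"
    then obtain j where j: "?ys = [j]" "g j = a" unfolding eq by (cases ?ys) auto
    from j(1) have "set ?ys = {j}" by simp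
    then show "a \<noteq> 0 \<and> (\<exists>j<l. g j = a \<and> (\<forall>j'<l. j' \<noteq> j \<longrightarrow> g j' = 0))"
      using j(2) by fastforce
  next
    assume "a \<noteq> 0 \<and> (\<exists>j<l. g j = a \<and> (\<forall>j'<l. j' \<noteq> j \<longrightarrow> g j' = 0))"
    then obtain j where j: "a \<noteq> 0" "j < l" "g j = a" "\<forall>j'<l. j' \<noteq> j \<longrightarrow> g j' = 0" by blast
    then have st: "set ?ys = {j}" by auto
    \<comment> \<open>A distinct list whose set has one element has length one.\<close>
    have "distinct ?ys" by simp
    from distinct_card[OF this] have "length ?ys = Suc 0" unfolding st by simp
    then obtain x where x: "?ys = [x]" by (auto simp only: length_Suc_conv length_0_conv)
    have "set [x] = {j}" using st unfolding x .
    then have "?ys = [j]" using x by simp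
    then show "filter (\<lambda>a. a \<noteq> 0) (map g [0..<l]) = [a]" using j(3) unfolding eq by simp
  }
qed

lemma NN_comp_mat_eq_rows_iff:
  assumes M: "M \<in> NN \<mu> \<nu>" and \<mu>: "0 \<notin> set \<mu>"
  shows "comp_mat M = \<mu> \<longleftrightarrow> (\<forall>i<length \<mu>. \<exists>j<length \<nu>. M $$ (i, j) = \<mu> ! i \<and>
    (\<forall>j'<length \<nu>. j' \<noteq> j \<longrightarrow> M $$ (i, j') = 0))"
proof -
  have car: "M \<in> carrier_mat (length \<mu>) (length \<nu>)" using M by (auto simp: NN_def)
  have "comp_mat M = \<mu> \<longleftrightarrow> map (filter (\<lambda>a. a \<noteq> 0)) (mat_to_list M) = map (\<lambda>a. [a]) \<mu>"
    using NN_rows[OF M \<mu>] by (auto simp: comp_mat_def filter_concat)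
  also have "map (\<lambda>a. [a]) \<mu> = map (\<lambda>i. [\<mu> ! i]) [0..<length \<mu>]"
    by (rule nth_equalityI) auto
  also have "map (filter (\<lambda>a. a \<noteq> 0)) (mat_to_list M) =
      map (\<lambda>i. filter (\<lambda>a. a \<noteq> 0) (map (\<lambda>j. M $$ (i, j)) [0..<length \<nu>])) [0..<length \<mu>]"
    using car by (simp add: mat_to_list_def)
  also have "\<dots> = map (\<lambda>i. [\<mu> ! i]) [0..<length \<mu>] \<longleftrightarrow>
      (\<forall>i<length \<mu>. filter (\<lambda>a. a \<noteq> 0) (map (\<lambda>j. M $$ (i, j)) [0..<length \<nu>]) = [\<mu> ! i])"
    unfolding map_eq_conv by auto
  finally show ?thesis
    unfolding filter_nonzero_eq_singleton_iff using \<mu> by (metis nth_mem)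
qed

definition fibre_mat :: "int list \<Rightarrow> nat \<Rightarrow> (nat \<Rightarrow> nat) \<Rightarrow> int mat" where
  "fibre_mat lam l f = mat (length lam) l (\<lambda>(i, j). if f i = j then lam ! i else 0)"

text \<open>By \<open>NN_comp_mat_eq_rows_iff\<close> the column of the only nonzero entry of each
  row defines \<open>f\<close>. Column sums become the fibre condition, and a negative column admits
  no positive entry, which is the sign condition. The remaining sign requirements of
  \<open>NN\<close> hold because the entry in row i is \<open>lam ! i\<close> itself.\<close>

lemma bij_betw_fibre_mat:
  assumes lam: "0 \<notin> set lam"
  shows "bij_betw (fibre_mat lam (length \<alpha>))
    (fibre_maps {..<length lam} ((!) lam) {..<length \<alpha>} ((!) \<alpha>)) {M. M \<in> NN lam \<alpha> \<and> comp_mat M = lam}"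
proof (rule bij_betw_imageI)
  let ?k = "length lam" and ?l = "length \<alpha>"
  let ?F = "fibre_maps {..<?k} ((!) lam) {..<?l} ((!) \<alpha>)"
  have nz: "lam ! i \<noteq> 0" if "i < ?k" for i using lam that by (metis nth_mem)
  have fneg: "lam ! i < 0" if "f \<in> ?F" "i < ?k" "\<alpha> ! f i < 0" for f i
    using that by (auto simp: fibre_maps_def)
  have fl: "f i < ?l" if "f \<in> ?F" "i < ?k" for f i using that by (auto simp: fibre_maps_def)
  show "inj_on (fibre_mat lam ?l) ?F"
  proof (rule inj_onI)
    fix f g assume fg: "f \<in> ?F" "g \<in> ?F" and eq: "fibre_mat lam ?l f = fibre_mat lam ?l g"
    have ext: "f \<in> {..<?k} \<rightarrow>\<^sub>E {..<?l}" "g \<in> {..<?k} \<rightarrow>\<^sub>E {..<?l}" using fg by (auto simp: fibre_maps_def)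
    show "f = g"
    proof (rule PiE_ext[OF ext])
      fix i assume "i \<in> {..<?k}"
      then have i: "i < ?k" by simp
      have "fibre_mat lam ?l f $$ (i, f i) = fibre_mat lam ?l g $$ (i, f i)" using eq by simp
      then show "f i = g i" using i fl[OF fg(1) i] nz[OF i] by (auto simp: fibre_mat_def split: if_splits)
    qed
  qed
  have col: "(\<Sum>i<?k. \<bar>if f i = j then lam ! i else 0\<bar>) = (\<Sum>i | i \<in> {..<?k} \<and> f i = j. \<bar>lam ! i\<bar>)" for f j
    by (subst sum.inter_filter) (auto intro: sum.cong)
  show "fibre_mat lam ?l ` ?F = {M. M \<in> NN lam \<alpha> \<and> comp_mat M = lam}"
  proof (rule equalityI; rule subsetI)
    fix M assume "M \<in> fibre_mat lam ?l ` ?F"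
    then obtain f where f: "f \<in> ?F" and M: "M = fibre_mat lam ?l f" by blast
    have ent: "M $$ (i, j) = (if f i = j then lam ! i else 0)" if "i < ?k" "j < ?l" for i j
      using that by (simp add: M fibre_mat_def)
    have "(\<Sum>j<?l. \<bar>M $$ (i, j)\<bar>) = \<bar>lam ! i\<bar>" if "i < ?k" for i
    proof -
      have "(\<Sum>j<?l. \<bar>M $$ (i, j)\<bar>) = (\<Sum>j<?l. if f i = j then \<bar>lam ! i\<bar> else 0)"
        using that ent by (intro sum.cong) auto
      then show ?thesis using fl[OF f that] by simp
    qed
    moreover have "(\<Sum>i<?k. \<bar>M $$ (i, j)\<bar>) = \<bar>\<alpha> ! j\<bar>" if "j < ?l" for j
      using f that ent col[of f j] by (simp add: fibre_maps_def)
    moreover have "lam ! i < 0 \<or> \<alpha> ! j < 0 \<longrightarrow> M $$ (i, j) \<le> 0"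
        "lam ! i > 0 \<and> \<alpha> ! j > 0 \<longrightarrow> M $$ (i, j) \<ge> 0" if "i < ?k" "j < ?l" for i j
      using fneg[OF f that(1)] ent[OF that] by (auto split: if_splits)
    moreover have "M \<in> carrier_mat ?k ?l" by (simp add: M fibre_mat_def)
    ultimately have NN: "M \<in> NN lam \<alpha>" unfolding NN_def by blast
    have "\<exists>j<?l. M $$ (i, j) = lam ! i \<and> (\<forall>j'<?l. j' \<noteq> j \<longrightarrow> M $$ (i, j') = 0)" if "i < ?k" for i
      using ent[OF that] fl[OF f that] by (intro exI[of _ "f i"]) auto
    then show "M \<in> {M. M \<in> NN lam \<alpha> \<and> comp_mat M = lam}"
      using NN_comp_mat_eq_rows_iff[OF NN lam] NN by blast
  next
    fix M assume "M \<in> {M. M \<in> NN lam \<alpha> \<and> comp_mat M = lam}"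
    then have M: "M \<in> NN lam \<alpha>" "comp_mat M = lam" by auto
    then have "\<forall>i\<in>{..<?k}. \<exists>j. j < ?l \<and> M $$ (i, j) = lam ! i \<and> (\<forall>j'<?l. j' \<noteq> j \<longrightarrow> M $$ (i, j') = 0)"
      unfolding NN_comp_mat_eq_rows_iff[OF M(1) lam] by simp
    from bchoice[OF this] obtain f0 where f0: "\<And>i. i < ?k \<Longrightarrow> f0 i < ?l \<and> M $$ (i, f0 i) = lam ! i \<and>
      (\<forall>j<?l. j \<noteq> f0 i \<longrightarrow> M $$ (i, j) = 0)"
      by auto
    \<comment> \<open>Restriction makes the chosen function extensional, as membership in
      \<open>fibre_maps\<close> demands.\<close>
    define f where "f = restrict f0 {..<?k}"
    have f: "f i < ?l" and ent: "j < ?l \<Longrightarrow> M $$ (i, j) = (if f i = j then lam ! i else 0)" if "i < ?k" for i j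
      using f0[OF that] that by (auto simp: f_def)
    have "M = fibre_mat lam ?l f"
      using M(1) ent by (intro eq_matI) (auto simp: fibre_mat_def NN_def)
    moreover have "f \<in> ?F"
    proof -
      have "(\<Sum>i | i \<in> {..<?k} \<and> f i = j. \<bar>lam ! i\<bar>) = \<bar>\<alpha> ! j\<bar>" if "j < ?l" for j
        using M(1) that ent col[of f j] by (simp add: NN_def)
      moreover have "lam ! i < 0" if "i < ?k" "\<alpha> ! f i < 0" for i
      proof -
        have "M $$ (i, f i) \<le> 0" using M(1) that f[OF that(1)] by (auto simp: NN_def)
        then show ?thesis using ent[OF that(1) f[OF that(1)]] nz[OF that(1)] by simp
      qed
      ultimately show ?thesis using f by (auto simp: fibre_maps_def f_def)
    qed
    ultimately show "M \<in> fibre_mat lam ?l ` ?F" by blast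
  qed
qed

text \<open>The weight is summed by columns. Over a negative part of \<alpha> the sign condition
  makes the whole fibre negative, so the column contributes its absolute fibre sum, the absolute
  value of that part. The other columns contribute 0.\<close>

lemma wt_fibre_mat:
  assumes lam: "0 \<notin> set lam"
    and f: "f \<in> fibre_maps {..<length lam} ((!) lam) {..<length \<alpha>} ((!) \<alpha>)"
  shows "wt lam \<alpha> (fibre_mat lam (length \<alpha>) f) = negpart {..<length \<alpha>} ((!) \<alpha>)"
proof -
  let ?k = "length lam" and ?l = "length \<alpha>"
  have NN: "fibre_mat lam ?l f \<in> NN lam \<alpha>"
    using bij_betw_fibre_mat[OF lam, of \<alpha>] f by (auto simp: bij_betw_def)
  have "wt lam \<alpha> (fibre_mat lam ?l f) =
      (\<Sum>i<?k. \<Sum>j<?l. if lam ! i < 0 \<and> \<alpha> ! j < 0 then nat (- (if f i = j then lam ! i else 0)) else 0)"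
    unfolding wt_eq[OF NN] by (intro sum.cong refl) (simp add: fibre_mat_def)
  also have "\<dots> =
      (\<Sum>j<?l. \<Sum>i<?k. if lam ! i < 0 \<and> \<alpha> ! j < 0 then nat (- (if f i = j then lam ! i else 0)) else 0)"
    by (rule sum.swap)
  also have "\<dots> = (\<Sum>j<?l. nat (- \<alpha> ! j))"
  proof (rule sum.cong[OF refl])
    fix j assume j: "j \<in> {..<?l}"
    show "(\<Sum>i<?k. if lam ! i < 0 \<and> \<alpha> ! j < 0 then nat (- (if f i = j then lam ! i else 0)) else 0) = nat (- \<alpha> ! j)"
    proof (cases "\<alpha> ! j < 0")
      case True
      have "(\<Sum>i<?k. if lam ! i < 0 \<and> \<alpha> ! j < 0 then nat (- (if f i = j then lam ! i else 0)) else 0) =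
          (\<Sum>i<?k. if f i = j then nat \<bar>lam ! i\<bar> else 0)"
        using True f by (intro sum.cong) (auto simp: fibre_maps_def)
      also have "\<dots> = (\<Sum>i | i \<in> {..<?k} \<and> f i = j. nat \<bar>lam ! i\<bar>)"
        by (subst sum.inter_filter) auto
      also have "int \<dots> = (\<Sum>i | i \<in> {..<?k} \<and> f i = j. \<bar>lam ! i\<bar>)" by simp
      also have "\<dots> = \<bar>\<alpha> ! j\<bar>" using f j by (auto simp: fibre_maps_def)
      finally show ?thesis
        using True by (subst nat_int[symmetric]) (simp only: abs_of_neg)
    qed simp
  qed
  finally show ?thesis by (simp add: negpart_def)
qed

abbreviation part_maps :: "int list \<Rightarrow> int list \<Rightarrow> (nat \<Rightarrow> nat) set" where
  "part_maps lam \<alpha> \<equiv> fibre_maps {..<length lam} ((!) lam) {..<length \<alpha>} ((!) \<alpha>)"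

abbreviation negsum :: "int list \<Rightarrow> nat" where
  "negsum \<alpha> \<equiv> negpart {..<length \<alpha>} ((!) \<alpha>)"

lemma dcoeff_diagonal:
  fixes q :: "'a::comm_semiring_1"
  assumes lam: "0 \<notin> set lam"
  shows "dcoeff lam \<alpha> lam q = of_nat (card (part_maps lam \<alpha>)) * q ^ negsum \<alpha>"
proof -
  note bij = bij_betw_fibre_mat[OF lam, of \<alpha>]
  have "dcoeff lam \<alpha> lam q = (\<Sum>f\<in>part_maps lam \<alpha>. q ^ wt lam \<alpha> (fibre_mat lam (length \<alpha>) f))"
    unfolding dcoeff_def by (rule sum.reindex_bij_betw[OF bij, symmetric])
  also have "\<dots> = (\<Sum>f\<in>part_maps lam \<alpha>. q ^ negsum \<alpha>)"
    by (intro sum.cong) (auto simp: wt_fibre_mat[OF lam])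
  finally show ?thesis by simp
qed

section \<open>Multiplicativity, unit and permutation invariance of the diagonal
  coefficients\<close>

text \<open>The identity holds cell by cell. A cell whose row and column are both negative counts
  twice on either side, a cell with exactly one of them negative counts once, and otherwise the
  entry is nonnegative and counts 0. Thus the total power of \<open>q\<close> is the same for all
  matrices in \<open>NN \<alpha> \<beta>\<close>.\<close>

lemma negsum_NN:
  assumes M: "M \<in> NN \<alpha> \<beta>" and nz: "0 \<notin> set \<alpha>" "0 \<notin> set \<beta>"
  shows "wt \<alpha> \<beta> M + negsum (comp_mat M) = negsum \<alpha> + negsum \<beta>"
proof -
  let ?k = "length \<alpha>" and ?l = "length \<beta>"
  have car: "M \<in> carrier_mat ?k ?l" using M by (auto simp: NN_def)
  have a: "nat (- \<alpha> ! i) = (\<Sum>j<?l. if \<alpha> ! i < 0 then nat \<bar>M $$ (i, j)\<bar> else 0)" if "i < ?k" for i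
  proof (cases "\<alpha> ! i < 0")
    case True
    have "int (\<Sum>j<?l. nat \<bar>M $$ (i, j)\<bar>) = \<bar>\<alpha> ! i\<bar>" using M that by (simp add: NN_def)
    from arg_cong[OF this, of nat] have "(\<Sum>j<?l. nat \<bar>M $$ (i, j)\<bar>) = nat \<bar>\<alpha> ! i\<bar>"
      unfolding nat_int .
    then show ?thesis using True by simp
  qed simp
  have b: "nat (- \<beta> ! j) = (\<Sum>i<?k. if \<beta> ! j < 0 then nat \<bar>M $$ (i, j)\<bar> else 0)" if "j < ?l" for j
  proof (cases "\<beta> ! j < 0")
    case True
    have "int (\<Sum>i<?k. nat \<bar>M $$ (i, j)\<bar>) = \<bar>\<beta> ! j\<bar>" using M that by (simp add: NN_def)
    from arg_cong[OF this, of nat] have "(\<Sum>i<?k. nat \<bar>M $$ (i, j)\<bar>) = nat \<bar>\<beta> ! j\<bar>"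
      unfolding nat_int .
    then show ?thesis using True by simp
  qed simp
  have A: "negsum \<alpha> = (\<Sum>i<?k. \<Sum>j<?l. if \<alpha> ! i < 0 then nat \<bar>M $$ (i, j)\<bar> else 0)"
    unfolding negpart_def using a by (intro sum.cong) auto
  have "negsum \<beta> = (\<Sum>j<?l. \<Sum>i<?k. if \<beta> ! j < 0 then nat \<bar>M $$ (i, j)\<bar> else 0)"
    unfolding negpart_def using b by (intro sum.cong) auto
  also have "\<dots> = (\<Sum>i<?k. \<Sum>j<?l. if \<beta> ! j < 0 then nat \<bar>M $$ (i, j)\<bar> else 0)"
    by (rule sum.swap)
  finally have B: "negsum \<beta> = \<dots>" .
  have "negsum (comp_mat M) = (\<Sum>p\<in>{..<?k} \<times> {..<?l}. nat (- (M $$ p)))"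
    by (simp only: negpart_comp_mat[OF car]) (simp only: negpart_def)
  also have "\<dots> = (\<Sum>i<?k. \<Sum>j<?l. nat (- (M $$ (i, j))))"
    by (simp only: sum.cartesian_product case_prod_unfold prod.collapse)
  finally have "wt \<alpha> \<beta> M + negsum (comp_mat M) = (\<Sum>i<?k. \<Sum>j<?l.
      (if \<alpha> ! i < 0 \<and> \<beta> ! j < 0 then nat (- (M $$ (i, j))) else 0) + nat (- (M $$ (i, j))))"
    by (simp only: wt_eq[OF M] sum.distrib)
  also have "\<dots> = (\<Sum>i<?k. \<Sum>j<?l. (if \<alpha> ! i < 0 then nat \<bar>M $$ (i, j)\<bar> else 0) +
      (if \<beta> ! j < 0 then nat \<bar>M $$ (i, j)\<bar> else 0))"
  proof (intro sum.cong refl)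
    fix i j assume "i \<in> {..<?k}" "j \<in> {..<?l}"
    then have ij: "i < ?k" "j < ?l" by auto
    have "\<alpha> ! i \<noteq> 0" "\<beta> ! j \<noteq> 0" using nz ij by (metis nth_mem)+
    moreover have "\<alpha> ! i < 0 \<or> \<beta> ! j < 0 \<longrightarrow> M $$ (i, j) \<le> 0" "\<alpha> ! i > 0 \<and> \<beta> ! j > 0 \<longrightarrow> M $$ (i, j) \<ge> 0"
      using M ij unfolding NN_def by blast+
    ultimately show "(if \<alpha> ! i < 0 \<and> \<beta> ! j < 0 then nat (- (M $$ (i, j))) else 0) + nat (- (M $$ (i, j))) =
      (if \<alpha> ! i < 0 then nat \<bar>M $$ (i, j)\<bar> else 0) + (if \<beta> ! j < 0 then nat \<bar>M $$ (i, j)\<bar> else 0)"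
      by (auto simp: abs_if)
  qed
  also have "\<dots> = negsum \<alpha> + negsum \<beta>" by (simp only: A B sum.distrib)
  finally show ?thesis .
qed

text \<open>With one coordinate fixed, the fibres of \<open>h\<close> over the pairs partition the
  fibre of that coordinate. These are the row and column sums of the matrix of joint fibre
  weights.\<close>

lemma sum_fibres_pair:
  assumes "finite I" "finite A" "finite B" and h: "\<And>r. r \<in> I \<Longrightarrow> h r \<in> A \<times> B"
  shows "(\<Sum>j\<in>B. \<Sum>r | r \<in> I \<and> h r = (i, j). v r) = (\<Sum>r | r \<in> I \<and> fst (h r) = i. v r)"
    and "(\<Sum>i\<in>A. \<Sum>r | r \<in> I \<and> h r = (i, j). v r) = (\<Sum>r | r \<in> I \<and> snd (h r) = j. v r)"
proof -
  have "(\<Sum>j\<in>B. \<Sum>r | r \<in> I \<and> h r = (i, j). v r) =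
      (\<Sum>j\<in>B. \<Sum>r\<in>{r \<in> {r \<in> I. fst (h r) = i}. snd (h r) = j}. v r)"
    by (intro sum.cong) (auto simp: prod_eq_iff)
  also have "\<dots> = (\<Sum>r | r \<in> I \<and> fst (h r) = i. v r)"
    by (rule sum.group) (use assms in \<open>auto simp: mem_Times_iff\<close>)
  finally show "(\<Sum>j\<in>B. \<Sum>r | r \<in> I \<and> h r = (i, j). v r) = (\<Sum>r | r \<in> I \<and> fst (h r) = i. v r)" .
  have "(\<Sum>i\<in>A. \<Sum>r | r \<in> I \<and> h r = (i, j). v r) =
      (\<Sum>i\<in>A. \<Sum>r\<in>{r \<in> {r \<in> I. snd (h r) = j}. fst (h r) = i}. v r)"
    by (intro sum.cong) (auto simp: prod_eq_iff)
  also have "\<dots> = (\<Sum>r | r \<in> I \<and> snd (h r) = j. v r)"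
    by (rule sum.group) (use assms in \<open>auto simp: mem_Times_iff\<close>)
  finally show "(\<Sum>i\<in>A. \<Sum>r | r \<in> I \<and> h r = (i, j). v r) = (\<Sum>r | r \<in> I \<and> snd (h r) = j. v r)" .
qed

text \<open>
  A pair \<open>(f, g)\<close> of fibre maps corresponds to the matrix of the weights of its joint fibres,
  with the signs forced by \<open>\<alpha>\<close> and \<open>\<beta>\<close>, together with the map \<open>r \<mapsto> (f r, g r)\<close> into its
  positions.
\<close>

lemma sum_card_fibre_maps_NN:
  assumes fin: "finite I" and w: "\<And>r. r \<in> I \<Longrightarrow> w r \<noteq> 0" and nz: "0 \<notin> set \<alpha>" "0 \<notin> set \<beta>"
  shows "(\<Sum>M\<in>NN \<alpha> \<beta>. card (fibre_maps I w ({..<length \<alpha>} \<times> {..<length \<beta>}) (($$) M))) =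
    card (fibre_maps I w {..<length \<alpha>} ((!) \<alpha>)) * card (fibre_maps I w {..<length \<beta>} ((!) \<beta>))"
proof -
  let ?k = "length \<alpha>" and ?l = "length \<beta>"
  let ?H = "\<lambda>M. fibre_maps I w ({..<?k} \<times> {..<?l}) (($$) M)"
  let ?P = "fibre_maps I w {..<?k} ((!) \<alpha>) \<times> fibre_maps I w {..<?l} ((!) \<beta>)"
  define N where "N f g = mat ?k ?l (\<lambda>(i, j). (if \<alpha> ! i < 0 \<or> \<beta> ! j < 0 then - 1 else 1) *
      (\<Sum>r | r \<in> I \<and> f r = i \<and> g r = j. \<bar>w r\<bar>))" for f g
  let ?F = "\<lambda>p. (\<lambda>r\<in>I. fst (snd p r), \<lambda>r\<in>I. snd (snd p r))"
  let ?G = "\<lambda>p. (N (fst p) (snd p), \<lambda>r\<in>I. (fst p r, snd p r))"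
  have sgn: "\<alpha> ! i \<noteq> 0" "\<beta> ! j \<noteq> 0" if "i < ?k" "j < ?l" for i j
    using nz that by (metis nth_mem)+
  have ent: "\<bar>N f g $$ (i, j)\<bar> = (\<Sum>r | r \<in> I \<and> (f r, g r) = (i, j). \<bar>w r\<bar>)" if "i < ?k" "j < ?l" for f g i j
  proof -
    have "0 \<le> (\<Sum>r | r \<in> I \<and> f r = i \<and> g r = j. \<bar>w r\<bar>)" by (rule sum_nonneg) simp
    then show ?thesis using that by (auto simp: N_def)
  qed
  have entsgn: "\<alpha> ! i < 0 \<or> \<beta> ! j < 0 \<Longrightarrow> N f g $$ (i, j) \<le> 0"
    "\<not> (\<alpha> ! i < 0 \<or> \<beta> ! j < 0) \<Longrightarrow> N f g $$ (i, j) \<ge> 0" if "i < ?k" "j < ?l" for f g i j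
  proof -
    have "0 \<le> (\<Sum>r | r \<in> I \<and> f r = i \<and> g r = j. \<bar>w r\<bar>)" by (rule sum_nonneg) simp
    then show "\<alpha> ! i < 0 \<or> \<beta> ! j < 0 \<Longrightarrow> N f g $$ (i, j) \<le> 0"
      "\<not> (\<alpha> ! i < 0 \<or> \<beta> ! j < 0) \<Longrightarrow> N f g $$ (i, j) \<ge> 0" using that by (auto simp: N_def)
  qed
  have car: "N f g \<in> carrier_mat ?k ?l" for f g by (simp add: N_def)
  have "bij_betw ?F (Sigma (NN \<alpha> \<beta>) ?H) ?P"
  proof (rule bij_betw_byWitness[where f' = ?G])
    show "\<forall>p\<in>Sigma (NN \<alpha> \<beta>) ?H. ?G (?F p) = p"
    proof
      fix p assume "p \<in> Sigma (NN \<alpha> \<beta>) ?H"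
      then obtain M h where p: "p = (M, h)" and M: "M \<in> NN \<alpha> \<beta>" and h: "h \<in> ?H M" by (rule SigmaE)
      let ?f = "\<lambda>r\<in>I. fst (h r)" and ?g = "\<lambda>r\<in>I. snd (h r)"
      have "N ?f ?g = M"
      proof (rule eq_matI)
        fix i j assume "i < dim_row M" "j < dim_col M"
        then have ij: "i < ?k" "j < ?l" using M by (auto simp: NN_def)
        have "\<bar>N ?f ?g $$ (i, j)\<bar> = (\<Sum>r | r \<in> I \<and> h r = (i, j). \<bar>w r\<bar>)"
          unfolding ent[OF ij] by (intro sum.cong) (auto simp: prod_eq_iff)
        also have "\<dots> = \<bar>M $$ (i, j)\<bar>" using h ij by (auto simp: fibre_maps_def)
        \<comment> \<open>The absolute values agree and the signs are forced: no part is 0, so a row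
          and a column that are not negative are positive, and there \<open>NN\<close> requires a
          nonnegative entry.\<close>
        finally show "N ?f ?g $$ (i, j) = M $$ (i, j)"
          using entsgn[OF ij, of ?f ?g] M ij sgn[OF ij] unfolding NN_def
          by (cases "\<alpha> ! i < 0 \<or> \<beta> ! j < 0") force+
      qed (use M in \<open>auto simp: NN_def N_def\<close>)
      moreover have "(\<lambda>r\<in>I. (?f r, ?g r)) = h"
        using h by (auto simp: fibre_maps_def PiE_iff extensional_def)
      ultimately show "?G (?F p) = p" unfolding p by simp
    qed
    show "\<forall>p\<in>?P. ?F (?G p) = p"
      by (auto simp: fibre_maps_def PiE_iff extensional_def)
    show "?F ` Sigma (NN \<alpha> \<beta>) ?H \<subseteq> ?P"
    proof (rule image_subsetI)
      fix p assume "p \<in> Sigma (NN \<alpha> \<beta>) ?H"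
      then obtain M h where p: "p = (M, h)" and M: "M \<in> NN \<alpha> \<beta>" and h: "h \<in> ?H M" by (rule SigmaE)
      have hr: "fst (h r) < ?k" "snd (h r) < ?l" "h r \<in> {..<?k} \<times> {..<?l}" if "r \<in> I" for r
        using h that by (auto simp: fibre_maps_def PiE_iff mem_Times_iff)
      have Mh: "(\<Sum>r | r \<in> I \<and> h r = (i, j). \<bar>w r\<bar>) = \<bar>M $$ (i, j)\<bar>" if "i < ?k" "j < ?l" for i j
        using h that by (auto simp: fibre_maps_def)
      \<comment> \<open>A cell hit by \<open>h\<close> is nonzero, and \<open>NN\<close> makes it
        negative as soon as its row or column is; the sign condition on \<open>h\<close> then
        applies.\<close>
      have neg: "w r < 0" if r: "r \<in> I" and "\<alpha> ! fst (h r) < 0 \<or> \<beta> ! snd (h r) < 0" for r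
      proof -
        have "M $$ h r \<noteq> 0" by (rule fibre_maps_target_nonzero[OF fin h r w[OF r]])
        moreover have "M $$ (fst (h r), snd (h r)) \<le> 0" using M that hr[OF r] by (auto simp: NN_def)
        ultimately show ?thesis using h r by (auto simp: fibre_maps_def)
      qed
      have "(\<Sum>r | r \<in> I \<and> fst (h r) = i. \<bar>w r\<bar>) = \<bar>\<alpha> ! i\<bar>" if "i < ?k" for i
        using sum_fibres_pair(1)[where v = "\<lambda>r. \<bar>w r\<bar>" and i = i and h = h, OF fin finite_lessThan finite_lessThan hr(3)]
          Mh that M by (simp add: NN_def)
      then have "(\<Sum>r | r \<in> I \<and> (\<lambda>r\<in>I. fst (h r)) r = i. \<bar>w r\<bar>) = \<bar>\<alpha> ! i\<bar>" if "i < ?k" for i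
        using that by (simp cong: conj_cong)
      then have "(\<lambda>r\<in>I. fst (h r)) \<in> fibre_maps I w {..<?k} ((!) \<alpha>)"
        using neg hr by (auto simp: fibre_maps_def)
      moreover have "(\<Sum>r | r \<in> I \<and> snd (h r) = j. \<bar>w r\<bar>) = \<bar>\<beta> ! j\<bar>" if "j < ?l" for j
        using sum_fibres_pair(2)[where v = "\<lambda>r. \<bar>w r\<bar>" and j = j and h = h, OF fin finite_lessThan finite_lessThan hr(3)]
          Mh that M by (simp add: NN_def)
      then have "(\<Sum>r | r \<in> I \<and> (\<lambda>r\<in>I. snd (h r)) r = j. \<bar>w r\<bar>) = \<bar>\<beta> ! j\<bar>" if "j < ?l" for j
        using that by (simp cong: conj_cong)
      then have "(\<lambda>r\<in>I. snd (h r)) \<in> fibre_maps I w {..<?l} ((!) \<beta>)"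
        using neg hr by (auto simp: fibre_maps_def)
      ultimately show "?F p \<in> ?P" unfolding p by simp
    qed
    show "?G ` ?P \<subseteq> Sigma (NN \<alpha> \<beta>) ?H"
    proof (rule image_subsetI)
      fix p assume "p \<in> ?P"
      then obtain f g where p: "p = (f, g)" and f: "f \<in> fibre_maps I w {..<?k} ((!) \<alpha>)"
        and g: "g \<in> fibre_maps I w {..<?l} ((!) \<beta>)" by (rule SigmaE)
      have mem: "(f r, g r) \<in> {..<?k} \<times> {..<?l}" if "r \<in> I" for r
        using f g that by (auto simp: fibre_maps_def)
      have "(\<Sum>j<?l. \<bar>N f g $$ (i, j)\<bar>) = \<bar>\<alpha> ! i\<bar>" if "i < ?k" for i
        using sum_fibres_pair(1)[where v = "\<lambda>r. \<bar>w r\<bar>" and i = i and h = "\<lambda>r. (f r, g r)", OF fin finite_lessThan finite_lessThan mem]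
          ent[OF that] f that by (simp add: fibre_maps_def)
      moreover have "(\<Sum>i<?k. \<bar>N f g $$ (i, j)\<bar>) = \<bar>\<beta> ! j\<bar>" if "j < ?l" for j
        using sum_fibres_pair(2)[where v = "\<lambda>r. \<bar>w r\<bar>" and j = j and h = "\<lambda>r. (f r, g r)", OF fin finite_lessThan finite_lessThan mem]
          ent[OF _ that] g that by (simp add: fibre_maps_def)
      ultimately have NN: "N f g \<in> NN \<alpha> \<beta>" using car entsgn by (auto simp: NN_def)
      have fib: "(\<Sum>r | r \<in> I \<and> (\<lambda>r\<in>I. (f r, g r)) r = p. \<bar>w r\<bar>) = \<bar>N f g $$ p\<bar>"
        if "p \<in> {..<?k} \<times> {..<?l}" for p
        using that ent[of "fst p" "snd p" f g] by (auto simp: mem_Times_iff cong: conj_cong)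
      \<comment> \<open>Conversely, a negative cell lies in a negative row or column, so the sign
        condition on \<open>f\<close> or on \<open>g\<close> applies.\<close>
      have sign: "w r < 0" if r: "r \<in> I" and neg: "N f g $$ (f r, g r) < 0" for r
      proof -
        have "\<alpha> ! f r < 0 \<or> \<beta> ! g r < 0" using entsgn(2)[of "f r" "g r" f g] mem[OF r] neg by force
        then show ?thesis using f g r by (auto simp: fibre_maps_def)
      qed
      have "(\<lambda>r\<in>I. (f r, g r)) \<in> ?H (N f g)"
        unfolding fibre_maps_def
        by (intro CollectI conjI ballI impI fib) (use mem sign in auto)
      then show "?G p \<in> Sigma (NN \<alpha> \<beta>) ?H" using NN unfolding p by simp
    qed
  qed
  note bij_betw_same_card[OF this]
  moreover have "card (Sigma (NN \<alpha> \<beta>) ?H) = (\<Sum>M\<in>NN \<alpha> \<beta>. card (?H M))"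
    by (rule card_SigmaI) (simp_all add: finite_NN finite_fibre_maps[OF fin])
  ultimately show ?thesis by (simp add: card_cartesian_product)
qed

lemma signed_compositions_nonzero: "\<mu> \<in> signed_compositions n \<Longrightarrow> 0 \<notin> set \<mu>"
  by (simp add: signed_compositions_def)

text \<open>Grouping by composition turns the sum over \<sigma> into one sum over the matrices in
  \<open>NN \<alpha> \<beta>\<close>. By \<open>negsum_NN\<close> they all carry the same power of
  \<open>q\<close>, and by \<open>sum_card_fibre_maps_NN\<close> their counts add up to the
  product.\<close>

lemma dcoeff_diagonal_mult:
  fixes q :: "'a::comm_semiring_1"
  assumes lam: "0 \<notin> set lam" and "\<alpha> \<in> signed_compositions n" "\<beta> \<in> signed_compositions n"
  shows "(\<Sum>\<sigma>\<in>signed_compositions n. dcoeff \<alpha> \<beta> \<sigma> q * dcoeff lam \<sigma> lam q) =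
    dcoeff lam \<alpha> lam q * dcoeff lam \<beta> lam q"
proof -
  let ?H = "\<lambda>M. fibre_maps {..<length lam} ((!) lam) ({..<length \<alpha>} \<times> {..<length \<beta>}) (($$) M)"
  have nz: "0 \<notin> set \<alpha>" "0 \<notin> set \<beta>" using assms signed_compositions_nonzero by auto
  have lnz: "lam ! i \<noteq> 0" if "i \<in> {..<length lam}" for i using lam that by (metis nth_mem lessThan_iff)
  have "(\<Sum>\<sigma>\<in>signed_compositions n. dcoeff \<alpha> \<beta> \<sigma> q * dcoeff lam \<sigma> lam q) =
      (\<Sum>\<sigma>\<in>signed_compositions n. \<Sum>M\<in>{M \<in> NN \<alpha> \<beta>. comp_mat M = \<sigma>}.
         q ^ wt \<alpha> \<beta> M * dcoeff lam (comp_mat M) lam q)"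
    unfolding dcoeff_def[of \<alpha> \<beta>] sum_distrib_right by (intro sum.cong) auto
  also have "\<dots> = (\<Sum>M\<in>NN \<alpha> \<beta>. q ^ wt \<alpha> \<beta> M * dcoeff lam (comp_mat M) lam q)"
    by (rule sum.group) (use finite_NN finite_signed_compositions comp_mat_signed_composition[OF assms(2)] in auto)
  also have "\<dots> = (\<Sum>M\<in>NN \<alpha> \<beta>. of_nat (card (?H M)) * q ^ (negsum \<alpha> + negsum \<beta>))"
  proof (rule sum.cong[OF refl])
    fix M assume M: "M \<in> NN \<alpha> \<beta>"
    then have car: "M \<in> carrier_mat (length \<alpha>) (length \<beta>)" by (auto simp: NN_def)
    have "card (part_maps lam (comp_mat M)) = card (?H M)"
      by (rule card_fibre_maps_comp_mat[OF car finite_lessThan lnz])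
    then show "q ^ wt \<alpha> \<beta> M * dcoeff lam (comp_mat M) lam q = of_nat (card (?H M)) * q ^ (negsum \<alpha> + negsum \<beta>)"
      unfolding dcoeff_diagonal[OF lam] negsum_NN[OF M nz, symmetric] power_add by (simp add: ac_simps)
  qed
  also have "\<dots> = of_nat (\<Sum>M\<in>NN \<alpha> \<beta>. card (?H M)) * q ^ (negsum \<alpha> + negsum \<beta>)"
    by (simp add: sum_distrib_right)
  also have "\<dots> = dcoeff lam \<alpha> lam q * dcoeff lam \<beta> lam q"
    using sum_card_fibre_maps_NN[OF finite_lessThan lnz nz, of "length lam"]
    by (simp add: dcoeff_diagonal[OF lam] power_add ac_simps)
  finally show ?thesis .
qed

text \<open>The only map to a single part is constant, its fibre sum is \<open>n\<close>, and the
  power of \<open>q\<close> is \<open>q ^ 0\<close>, which is 1 even for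
  \<open>q = 0\<close>.\<close>

lemma dcoeff_diagonal_one:
  assumes lam: "lam \<in> signed_compositions n" and "n \<ge> 1"
  shows "dcoeff lam [int n] lam q = 1"
proof -
  have "part_maps lam [int n] = {\<lambda>i\<in>{..<length lam}. 0}"
  proof (rule equalityI; rule subsetI)
    fix f assume "f \<in> part_maps lam [int n]"
    then show "f \<in> {\<lambda>i\<in>{..<length lam}. 0}"
      by (auto simp: fibre_maps_def PiE_iff extensional_def)
  next
    have "(\<Sum>i<length lam. \<bar>lam ! i\<bar>) = (\<Sum>a\<leftarrow>lam. \<bar>a\<bar>)"
      by (simp add: sum_list_sum_nth atLeast0LessThan)
    also have "\<dots> = int n" using lam by (simp add: signed_compositions_def)
    finally have "(\<Sum>i | i < length lam. \<bar>lam ! i\<bar>) = int n" by (simp add: lessThan_def)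
    moreover fix f :: "nat \<Rightarrow> nat" assume "f \<in> {\<lambda>i\<in>{..<length lam}. 0}"
    ultimately show "f \<in> part_maps lam [int n]"
      by (auto simp: fibre_maps_def cong: conj_cong)
  qed
  then show ?thesis
    using dcoeff_diagonal[OF signed_compositions_nonzero[OF lam], of "[int n]" q] by (simp add: negpart_def)
qed

text \<open>A permutation of the parts only relabels the source of the fibre maps, while the power
  of \<open>q\<close> depends on \<alpha> alone.\<close>

lemma dcoeff_diagonal_perm:
  assumes "lam <~~> \<mu>" and lam: "0 \<notin> set lam"
  shows "dcoeff lam \<alpha> lam q = dcoeff \<mu> \<alpha> \<mu> q"
proof -
  obtain s where s: "bij_betw s {..<length lam} {..<length \<mu>}" "\<forall>i<length lam. lam ! i = \<mu> ! s i"
    using permutation_Ex_bij[OF assms(1)] by blast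
  have \<mu>: "0 \<notin> set \<mu>" using lam assms(1) mset_eq_setD by blast
  have "card (part_maps lam \<alpha>) = card (part_maps \<mu> \<alpha>)"
    by (rule card_fibre_maps_reindex[OF _ _ s(1), of _ id]) (use s(2) in auto)
  then show ?thesis by (simp add: dcoeff_diagonal[OF lam] dcoeff_diagonal[OF \<mu>])
qed

section \<open>The characters and the representations I(\<lambda>)\<close>

text \<open>The character is separated from the module on which I(\<lambda>) lives, so that it can
  serve as a scalar on any vector space.\<close>

definition I_char :: "nat \<Rightarrow> 'r::field \<Rightarrow> int list \<Rightarrow> (int list \<Rightarrow> 'r) \<Rightarrow> 'r" where
  "I_char n q lam f = (\<Sum>\<alpha>\<in>signed_compositions n. f \<alpha> * dcoeff lam \<alpha> lam q)"

lemma I_rep_eq: "I_rep n q lam f x = I_char n q lam f * x"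
  by (simp add: I_rep_def I_char_def)

lemma I_char_basis:
  assumes "\<alpha> \<in> signed_compositions n"
  shows "I_char n q lam (sq_basis \<alpha>) = dcoeff lam \<alpha> lam q"
proof -
  have "I_char n q lam (sq_basis \<alpha>) =
      (\<Sum>\<sigma>\<in>signed_compositions n. if \<sigma> = \<alpha> then dcoeff lam \<sigma> lam q else 0)"
    unfolding I_char_def sq_basis_def by (intro sum.cong) auto
  then show ?thesis using assms finite_signed_compositions by simp
qed

lemma I_char_mult:
  assumes "lam \<in> signed_compositions n"
  shows "I_char n q lam (sq_mult n q f g) = I_char n q lam f * I_char n q lam g"
proof -
  let ?S = "signed_compositions n"
  have "I_char n q lam (sq_mult n q f g) =
      (\<Sum>\<sigma>\<in>?S. \<Sum>\<mu>\<in>?S. \<Sum>\<nu>\<in>?S. f \<mu> * g \<nu> * (dcoeff \<mu> \<nu> \<sigma> q * dcoeff lam \<sigma> lam q))"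
    unfolding I_char_def sq_mult_def by (simp only: sum_distrib_right mult.assoc)
  \<comment> \<open>The sum over \<sigma> is moved innermost, where
    \<open>dcoeff_diagonal_mult\<close> applies.\<close>
  also have "\<dots> = (\<Sum>\<mu>\<in>?S. \<Sum>\<sigma>\<in>?S. \<Sum>\<nu>\<in>?S. f \<mu> * g \<nu> * (dcoeff \<mu> \<nu> \<sigma> q * dcoeff lam \<sigma> lam q))"
    by (rule sum.swap)
  also have "\<dots> = (\<Sum>\<mu>\<in>?S. \<Sum>\<nu>\<in>?S. \<Sum>\<sigma>\<in>?S. f \<mu> * g \<nu> * (dcoeff \<mu> \<nu> \<sigma> q * dcoeff lam \<sigma> lam q))"
    by (intro sum.cong refl sum.swap)
  also have "\<dots> = (\<Sum>\<mu>\<in>?S. \<Sum>\<nu>\<in>?S. f \<mu> * g \<nu> * (dcoeff lam \<mu> lam q * dcoeff lam \<nu> lam q))"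
    by (intro sum.cong refl)
      (simp add: sum_distrib_left[symmetric] dcoeff_diagonal_mult[OF signed_compositions_nonzero[OF assms]])
  also have "\<dots> = I_char n q lam f * I_char n q lam g"
    unfolding I_char_def sum_product by (intro sum.cong) (auto simp: ac_simps)
  finally show ?thesis .
qed

lemma vector_space_mult: "vector_space ((*) :: 'r::field \<Rightarrow> 'r \<Rightarrow> 'r)"
  by unfold_locales (auto simp: algebra_simps)

lemma sq_one_signed_composition: "n \<ge> 1 \<Longrightarrow> [int n] \<in> signed_compositions n"
  by (auto simp: signed_compositions_def)

lemma sq_representation_I_rep:
  assumes "lam \<in> signed_compositions n" and "n \<ge> 1"
  shows "sq_representation (*) n q (I_rep n q lam)"
  unfolding sq_representation_def
proof (rule conjI[OF vector_space_mult])
  show "sq_representation_axioms (*) n q (I_rep n q lam)"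
  proof (rule sq_representation_axioms.intro)
    show "Vector_Spaces.linear (*) (*) (I_rep n q lam f)" for f
      unfolding Vector_Spaces.linear_iff by (auto simp: I_rep_eq vector_space_mult algebra_simps)
    show "I_rep n q lam (\<lambda>\<mu>. f \<mu> + g \<mu>) v = I_rep n q lam f v + I_rep n q lam g v" for f g v
      by (simp add: I_rep_eq I_char_def algebra_simps sum.distrib)
    show "I_rep n q lam (\<lambda>\<mu>. c * f \<mu>) v = c * I_rep n q lam f v" for f c v
      by (simp add: I_rep_eq I_char_def mult.assoc sum_distrib_left)
    show "I_rep n q lam (sq_mult n q f g) v = I_rep n q lam f (I_rep n q lam g v)" for f g v
      by (simp add: I_rep_eq I_char_mult[OF assms(1)])
    show "I_rep n q lam (sq_one n) v = v" for v
      using assms by (simp add: I_rep_eq sq_one_def I_char_basis sq_one_signed_composition dcoeff_diagonal_one)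
  qed
qed

lemma dim_field_over_itself: "vector_space.dim (*) (UNIV :: 'r::field set) = 1"
proof -
  interpret vector_space "(*) :: 'r \<Rightarrow> 'r \<Rightarrow> 'r" by (rule vector_space_mult)
  show ?thesis
    by (rule dim_unique[of "{1}"]) (auto simp: span_singleton image_iff)
qed

section \<open>Products with basis elements and a criterion for isomorphism\<close>

lemma sq_basis_carrier: "\<mu> \<in> signed_compositions n \<Longrightarrow> sq_basis \<mu> \<in> sq_carrier n"
  by (auto simp: sq_carrier_def sq_basis_def)

lemma dcoeff_outside:
  assumes "\<mu> \<in> signed_compositions n" "\<sigma> \<notin> signed_compositions n"
  shows "dcoeff \<mu> \<nu> \<sigma> q = 0"
  using comp_mat_signed_composition[OF assms(1)] assms(2) by (intro dcoeff_eq_0) blast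

lemma sq_mult_carrier: "sq_mult n q f g \<in> sq_carrier n"
  by (auto simp: sq_carrier_def sq_mult_def dcoeff_outside intro!: sum.neutral)

lemma sq_mult_basis_left:
  assumes "\<sigma> \<in> signed_compositions n"
  shows "sq_mult n q (sq_basis \<sigma>) g \<tau> = (\<Sum>\<nu>\<in>signed_compositions n. g \<nu> * dcoeff \<sigma> \<nu> \<tau> q)"
proof -
  have "sq_mult n q (sq_basis \<sigma>) g \<tau> = (\<Sum>\<mu>\<in>signed_compositions n.
      if \<mu> = \<sigma> then (\<Sum>\<nu>\<in>signed_compositions n. g \<nu> * dcoeff \<mu> \<nu> \<tau> q) else 0)"
    unfolding sq_mult_def sq_basis_def by (intro sum.cong) auto
  then show ?thesis using assms finite_signed_compositions by simp
qed

text \<open>The isomorphism takes a vector to its coordinate with respect to \<open>b\<close>. As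
  the algebra acts by scalars on both sides, linearity already gives equivariance.\<close>

lemma isomorphic_I_repI:
  fixes scale :: "'r::field \<Rightarrow> 'v::ab_group_add \<Rightarrow> 'v"
  assumes "vector_space scale" and "b \<noteq> 0" and span: "\<And>v. \<exists>c. v = scale c b"
    and \<rho>: "\<And>f v. f \<in> sq_carrier n \<Longrightarrow> \<rho> f v = scale (I_char n q lam f) v"
  shows "isomorphic_representations n scale \<rho> (*) (I_rep n q lam)"
proof -
  interpret vector_space scale by fact
  obtain \<phi> where \<phi>: "\<And>v. v = scale (\<phi> v) b" using span by metis
  have inj: "c = d" if "scale c b = scale d b" for c d
    using that \<open>b \<noteq> 0\<close> by simp
  have \<phi>_scale: "\<phi> (scale c v) = c * \<phi> v" for c v
    by (rule inj) (metis \<phi> scale_scale)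
  have \<phi>_add: "\<phi> (v + w) = \<phi> v + \<phi> w" for v w
    by (rule inj) (metis \<phi> scale_left_distrib)
  have "bij \<phi>"
    by (rule bij_betw_byWitness[where f' = "\<lambda>c. scale c b"]) (use \<phi> inj in \<open>auto, metis\<close>)
  moreover have "Vector_Spaces.linear scale (*) \<phi>"
    by (auto simp: Vector_Spaces.linear_iff vector_space_mult \<phi>_add \<phi>_scale vector_space_axioms)
  ultimately show ?thesis
    unfolding isomorphic_representations_def using \<rho> \<phi>_scale by (auto simp: I_rep_eq)
qed

section \<open>Common eigenvectors in an arbitrary representation\<close>

context sq_representation
begin

lemma rep_expand:
  assumes f: "f \<in> sq_carrier n"
  shows "\<rho> f v = (\<Sum>\<mu>\<in>signed_compositions n. scale (f \<mu>) (\<rho> (sq_basis \<mu>) v))"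
proof -
  have "\<rho> (\<lambda>\<mu>. if \<mu> \<in> T then f \<mu> else 0) v = (\<Sum>\<mu>\<in>T. scale (f \<mu>) (\<rho> (sq_basis \<mu>) v))"
    if "finite T" "T \<subseteq> signed_compositions n" for T
    using that
  proof (induction T rule: finite_induct)
    case empty
    \<comment> \<open>The zero function is \<open>f\<close> multiplied by the scalar 0.\<close>
    show ?case using rep_scale[OF f, of 0 v] by simp
  next
    case (insert \<tau> T)
    then have \<tau>: "(sq_basis \<tau> :: _ \<Rightarrow> 'r) \<in> sq_carrier n" by (intro sq_basis_carrier) auto
    have "(\<lambda>\<mu>. if \<mu> \<in> insert \<tau> T then f \<mu> else 0) =
        (\<lambda>\<mu>. f \<tau> * sq_basis \<tau> \<mu> + (if \<mu> \<in> T then f \<mu> else 0))"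
      using insert.hyps by (auto simp: sq_basis_def)
    moreover have "(\<lambda>\<mu>. f \<tau> * sq_basis \<tau> \<mu>) \<in> sq_carrier n"
      "(\<lambda>\<mu>. if \<mu> \<in> T then f \<mu> else 0) \<in> sq_carrier n"
      using f \<tau> by (auto simp: sq_carrier_def)
    ultimately show ?case using insert rep_scale[OF \<tau>] by (simp add: rep_add)
  qed
  from this[OF finite_signed_compositions order_refl]
  moreover have "(\<lambda>\<mu>. if \<mu> \<in> signed_compositions n then f \<mu> else 0) = f"
    using f by (auto simp: sq_carrier_def)
  ultimately show ?thesis by simp
qed

lemma rep_eq_I_char:
  assumes "\<And>\<alpha>. \<alpha> \<in> signed_compositions n \<Longrightarrow> \<rho> (sq_basis \<alpha>) v = scale (dcoeff lam \<alpha> lam q) v"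
    and "f \<in> sq_carrier n"
  shows "\<rho> f v = scale (I_char n q lam f) v"
  unfolding rep_expand[OF assms(2)] using assms(1) by (simp add: I_char_def scale_sum_left)

text \<open>
  By triangularity the span of the \<open>E\<^sub>\<sigma>\<close>, \<open>\<sigma> \<in> S\<close>, is a right ideal. If \<open>lam\<close> has maximal
  rank outside \<open>S\<close>, then right multiplication by \<open>f - I_char n q lam f\<close> maps the basis vector
  of \<open>lam\<close> into this span, so either \<open>w\<close> is an eigenvector for the character of \<open>lam\<close> or some
  \<open>\<rho> f w - I_char n q lam f w\<close> is a nonzero vector killed by the larger upper set
  \<open>insert lam S\<close>. This stops, since the identity kills no nonzero vector.
\<close>

lemma exists_eigenvector:
  assumes n: "n \<ge> 1" and "S \<subseteq> signed_compositions n"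
    and "\<And>\<sigma> \<tau>. \<sigma> \<in> S \<Longrightarrow> \<tau> \<in> signed_compositions n \<Longrightarrow> sc_rank \<sigma> < sc_rank \<tau> \<Longrightarrow> \<tau> \<in> S"
    and "w \<noteq> 0" and "\<And>\<sigma>. \<sigma> \<in> S \<Longrightarrow> \<rho> (sq_basis \<sigma>) w = 0"
  shows "\<exists>lam\<in>signed_compositions n. \<exists>w. w \<noteq> 0 \<and> (\<forall>f\<in>sq_carrier n. \<rho> f w = scale (I_char n q lam f) w)"
  using assms(2-)
proof (induction "card (signed_compositions n - S)" arbitrary: S w rule: less_induct)
  case less
  let ?SC = "signed_compositions n"
  have "[int n] \<notin> S"
    using less.prems(3,4) rep_one[of w] by (auto simp: sq_one_def)
  then have ne: "?SC - S \<noteq> {}" using sq_one_signed_composition[OF n] by blast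
  have fin: "finite (?SC - S)" using finite_signed_compositions by blast
  obtain lam where lam: "lam \<in> ?SC" "lam \<notin> S"
    and max: "\<And>\<tau>. \<tau> \<in> ?SC - S \<Longrightarrow> sc_rank \<tau> \<le> sc_rank lam"
  proof -
    have "Max (sc_rank ` (?SC - S)) \<in> sc_rank ` (?SC - S)" using ne fin by (intro Max_in) auto
    then obtain l where "l \<in> ?SC - S" "sc_rank l = Max (sc_rank ` (?SC - S))" by auto
    then show thesis using that[of l] fin by auto
  qed
  show ?case
  proof (cases "\<forall>f\<in>sq_carrier n. \<rho> f w = scale (I_char n q lam f) w")
    case True
    then show ?thesis using lam(1) less.prems(3) by blast
  next
    case False
    then obtain f where f: "f \<in> sq_carrier n" and ne: "\<rho> f w \<noteq> scale (I_char n q lam f) w" by blast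
    let ?w = "\<rho> f w - scale (I_char n q lam f) w"
    \<comment> \<open>A composition of larger rank than \<open>lam\<close> lies in \<open>S\<close>
      by the maximality of \<open>lam\<close>, so \<open>insert lam S\<close> is again an upper
      set.\<close>
    have up: "\<tau> \<in> S" if "\<sigma> \<in> insert lam S" "\<tau> \<in> ?SC" "sc_rank \<sigma> < sc_rank \<tau>" for \<sigma> \<tau>
      using that less.prems(2) max[of \<tau>] by force
    have "\<rho> (sq_basis \<sigma>) ?w = 0" if \<sigma>: "\<sigma> \<in> insert lam S" for \<sigma>
    proof -
      have SC: "\<sigma> \<in> ?SC" using \<sigma> lam less.prems(1) by blast
      note car = sq_basis_carrier[OF SC]
      interpret lin: Vector_Spaces.linear scale scale "\<rho> (sq_basis \<sigma>)" by (rule linear_rep[OF car])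
      have "\<rho> (sq_basis \<sigma>) ?w = \<rho> (sq_mult n q (sq_basis \<sigma>) f) w - scale (I_char n q lam f) (\<rho> (sq_basis \<sigma>) w)"
        by (simp add: lin.diff lin.scale rep_mult[OF car f])
      also have "\<rho> (sq_mult n q (sq_basis \<sigma>) f) w =
          (\<Sum>\<tau>\<in>?SC. scale (\<Sum>\<nu>\<in>?SC. f \<nu> * dcoeff \<sigma> \<nu> \<tau> q) (\<rho> (sq_basis \<tau>) w))"
        unfolding rep_expand[OF sq_mult_carrier] sq_mult_basis_left[OF SC] ..
      \<comment> \<open>Every \<tau> other than \<sigma> drops out: if \<tau> lies in
        \<open>S\<close>, its basis element kills \<open>w\<close>; otherwise the coefficient is 0,
        as triangularity and \<open>up\<close> would put \<tau> into \<open>S\<close>.\<close>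
      also have "\<dots> = (\<Sum>\<tau>\<in>?SC. if \<tau> = \<sigma> then scale (I_char n q \<sigma> f) (\<rho> (sq_basis \<sigma>) w) else 0)"
      proof (rule sum.cong[OF refl])
        fix \<tau> assume \<tau>: "\<tau> \<in> ?SC"
        show "scale (\<Sum>\<nu>\<in>?SC. f \<nu> * dcoeff \<sigma> \<nu> \<tau> q) (\<rho> (sq_basis \<tau>) w) =
            (if \<tau> = \<sigma> then scale (I_char n q \<sigma> f) (\<rho> (sq_basis \<sigma>) w) else 0)"
        proof (cases "\<tau> = \<sigma> \<or> \<tau> \<in> S")
          case True
          then show ?thesis using less.prems(4) by (auto simp: I_char_def)
        next
          case False
          then have "dcoeff \<sigma> \<nu> \<tau> q = 0" for \<nu>
            using dcoeff_triangular[OF signed_compositions_nonzero[OF SC]] up[OF \<sigma> \<tau>] by blast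
          then show ?thesis using False by simp
        qed
      qed
      also have "\<dots> = scale (I_char n q \<sigma> f) (\<rho> (sq_basis \<sigma>) w)"
        using SC finite_signed_compositions by simp
      \<comment> \<open>For \<sigma> equal to \<open>lam\<close> the two terms cancel; for \<sigma>
        in \<open>S\<close> both vanish because \<open>sq_basis \<sigma>\<close> kills
        \<open>w\<close>.\<close>
      finally show ?thesis using \<sigma> less.prems(4) by auto
    qed
    moreover have "card (?SC - insert lam S) < card (?SC - S)"
      using fin lam by (intro psubset_card_mono) auto
    ultimately show ?thesis
      using less.hyps[of "insert lam S" ?w] lam(1) less.prems(1) up ne by auto
  qed
qed

end

section \<open>Classification of irreducibles, uniqueness and permutation invariance of
  I(\<lambda>)\<close>

text \<open>The line through a common eigenvector is a nonzero invariant subspace, hence the whole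
  space, and its generator serves as \<open>b\<close> in \<open>isomorphic_I_repI\<close>.\<close>

lemma irreducible_isomorphic_I_rep:
  assumes n: "n \<ge> 1" and irr: "irreducible_representation scale n q \<rho>"
  shows "\<exists>lam\<in>signed_compositions n. isomorphic_representations n scale \<rho> (*) (I_rep n q lam)"
proof -
  interpret sq_representation scale n q \<rho> using irr by (simp add: irreducible_representation_def)
  obtain v0 :: 'b where "v0 \<noteq> 0" using irr by (auto simp: irreducible_representation_def)
  \<comment> \<open>For the empty set the closure and annihilation hypotheses are vacuous, so the
    search may start from any nonzero vector.\<close>
  then obtain lam w where lam: "lam \<in> signed_compositions n" and w: "w \<noteq> 0"
    and eig: "\<And>f. f \<in> sq_carrier n \<Longrightarrow> \<rho> f w = scale (I_char n q lam f) w"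
    using exists_eigenvector[OF n, of "{}" v0] by auto
  have eig': "\<rho> f (scale c w) = scale (I_char n q lam f) (scale c w)" if "f \<in> sq_carrier n" for f c
  proof -
    interpret lin: Vector_Spaces.linear scale scale "\<rho> f" by (rule linear_rep[OF that])
    show ?thesis using eig[OF that] by (simp add: lin.scale mult.commute)
  qed
  have "\<forall>f\<in>sq_carrier n. \<forall>x\<in>span {w}. \<rho> f x \<in> span {w}"
    using eig' by (auto simp: span_singleton)
  then have "span {w} = {0} \<or> span {w} = UNIV"
    using irr subspace_span by (auto simp: irreducible_representation_def)
  moreover have "w \<in> span {w}" by (simp add: span_base)
  ultimately have all: "\<exists>c. v = scale c w" for v using w by (auto simp: span_singleton)
  have "isomorphic_representations n scale \<rho> (*) (I_rep n q lam)"
    by (rule isomorphic_I_repI[OF vector_space_axioms w all]) (metis all eig')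
  then show ?thesis using lam by blast
qed

text \<open>This is the uniqueness in (a), up to isomorphism: a basis has one element, and the
  action of the basis elements extends linearly to the whole algebra.\<close>

lemma one_dim_isomorphic_I_rep:
  assumes one: "one_dim_representation scale n q \<rho>"
    and act: "\<And>\<alpha> v. \<alpha> \<in> signed_compositions n \<Longrightarrow> \<rho> (sq_basis \<alpha>) v = scale (dcoeff lam \<alpha> lam q) v"
  shows "isomorphic_representations n scale \<rho> (*) (I_rep n q lam)"
proof -
  interpret sq_representation scale n q \<rho> using one by (simp add: one_dim_representation_def)
  obtain B where B: "independent B" "UNIV \<subseteq> span B" "card B = 1"
    using basis_exists[of UNIV] one unfolding one_dim_representation_def by metis
  then obtain b where b: "B = {b}" by (auto simp: card_1_singleton_iff)
  have "\<exists>c. v = scale c b" for v using B(2) unfolding b span_singleton by blast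
  moreover have "b \<noteq> 0" using B(1) unfolding b by simp
  ultimately show ?thesis
    by (intro isomorphic_I_repI[OF vector_space_axioms]) (use rep_eq_I_char[OF act] in auto)
qed

text \<open>The two characters are the same function, so the two actions on the field coincide; the
  generator is 1.\<close>

lemma isomorphic_I_rep_perm:
  assumes "lam <~~> \<mu>" and "0 \<notin> set lam"
  shows "isomorphic_representations n (*) (I_rep n q lam) (*) (I_rep n q \<mu>)"
proof -
  have "I_char n q lam f = I_char n q \<mu> f" for f
    unfolding I_char_def dcoeff_diagonal_perm[OF assms] ..
  then show ?thesis
    by (intro isomorphic_I_repI[OF vector_space_mult, of 1]) (auto simp: I_rep_eq)
qed

theorem theorem8p3:
  fixes q :: "'r::field" and n :: nat
  assumes "n \<ge> 1"
  shows
    "(\<forall>lam\<in>signed_compositions n.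
        one_dim_representation ((*) :: 'r \<Rightarrow> 'r \<Rightarrow> 'r) n q (I_rep n q lam) \<and>
        (\<forall>\<alpha>\<in>signed_compositions n. \<forall>x. I_rep n q lam (sq_basis \<alpha>) x = dcoeff lam \<alpha> lam q * x) \<and>
        (\<forall>(scale :: 'r \<Rightarrow> 'v::ab_group_add \<Rightarrow> 'v) \<rho>.
           one_dim_representation scale n q \<rho> \<and>
           (\<forall>\<alpha>\<in>signed_compositions n. \<forall>v. \<rho> (sq_basis \<alpha>) v = scale (dcoeff lam \<alpha> lam q) v) \<longrightarrow>
           isomorphic_representations n scale \<rho> (*) (I_rep n q lam))) \<and>
     (\<forall>(scale :: 'r \<Rightarrow> 'w::ab_group_add \<Rightarrow> 'w) \<rho>.
        irreducible_representation scale n q \<rho> \<longrightarrow>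
        (\<exists>lam\<in>signed_compositions n. isomorphic_representations n scale \<rho> (*) (I_rep n q lam))) \<and>
     (\<forall>lam\<in>signed_compositions n. \<forall>\<mu>\<in>signed_compositions n. lam <~~> \<mu> \<longrightarrow>
        isomorphic_representations n (*) (I_rep n q lam) (*) (I_rep n q \<mu>))"
proof (intro conjI ballI allI impI)
  fix lam assume lam: "lam \<in> signed_compositions n"
  show "one_dim_representation (*) n q (I_rep n q lam)"
    unfolding one_dim_representation_def
    using sq_representation_I_rep[OF lam assms] dim_field_over_itself by blast
  show "I_rep n q lam (sq_basis \<alpha>) x = dcoeff lam \<alpha> lam q * x" if "\<alpha> \<in> signed_compositions n" for \<alpha> x
    using that by (simp add: I_rep_eq I_char_basis)
  show "isomorphic_representations n scale \<rho> (*) (I_rep n q lam)"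
    if "one_dim_representation scale n q \<rho> \<and>
      (\<forall>\<alpha>\<in>signed_compositions n. \<forall>v. \<rho> (sq_basis \<alpha>) v = scale (dcoeff lam \<alpha> lam q) v)"
    for scale :: "'r \<Rightarrow> 'v \<Rightarrow> 'v" and \<rho>
    using that by (intro one_dim_isomorphic_I_rep) auto
  show "isomorphic_representations n (*) (I_rep n q lam) (*) (I_rep n q \<mu>)" if "lam <~~> \<mu>" for \<mu>
    by (rule isomorphic_I_rep_perm[OF that signed_compositions_nonzero[OF lam]])
qed (rule irreducible_isomorphic_I_rep[OF assms])

end
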